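(* Let $ABCD$ be a curvilinear quadrilateral in the plane made of arcs of confocal ellipses and hyperbolas (one pair of opposite sides lies on two confocal ellipses, the other pair of opposite sides lies on confocal hyperbolas of the same family). Let $\gamma$ be the conic from the confocal family that is tangent to the line $BD$. Then there exists a 1-parameter family of 4-periodic billiard trajectories in the quadrilateral $ABCD$, interpolating between the diagonals $BD$ and $AC$, and consisting of rays tangent to $\gamma$. In particular, the line $AC$ is also tangent to $\gamma$. These 4-periodic trajectories have the same perimeter lengths, and hence $|AC|=|BD|$.
   Context: A confocal family of conics in the plane consists of the conics $\frac{x^2}{a-\lambda}+\frac{y^2}{b-\lambda}=1$, with $a>b>0$ fixed and $\lambda$ a parameter (ellipses for $\lambda<b$, hyperbolas for $b<\lambda<a$); confocal ellipses and hyperbolas intersect orthogonally. Billiard reflection: a ray hitting a curve is reflected so that the angle of incidence equals the angle of reflection. A 4-periodic billiard trajectory in $ABCD$ is a closed quadrilateral $PQRS$ with one vertex on each of the four sides of $ABCD$, in the cyclic order of the sides, such that consecutive segments are related by the reflection law at the corresponding side. At a corner (where the sides meet at a right angle) reflection is defined, by continuous extension, as the direction reversal of the ray; accordingly each diagonal $AC$ or $BD$ (a straight segment), traversed back and forth, is regarded as a (degenerate) 4-periodic billiard trajectory, of perimeter twice its length. "Rays tangent to $\gamma$" means that the lines containing the segments of the trajectory are tangent to $\gamma$. $|XY|$ denotes Euclidean distance.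
   Formalization: The formal theorem also assumes that ABCD contains no focus (so all interior angles are right angles) and that the segment BD lies in ABCD, without which the claim fails; asymptotes of γ count as tangent lines. *)

theory Defs
  imports "HOL-Analysis.Analysis"
begin

type_synonym point = "real \<times> real"

text \<open>
  The confocal family with parameters \<open>a > b > 0\<close>: its members are the ellipses \<open>l < b\<close> and the
  hyperbolas \<open>b < l < a\<close>.
\<close>

definition conic :: "real \<Rightarrow> real \<Rightarrow> real \<Rightarrow> point set" where
  "conic a b l = {(x, y). x\<^sup>2 / (a - l) + y\<^sup>2 / (b - l) = 1}"

definition is_ellipse :: "real \<Rightarrow> real \<Rightarrow> bool" where
  "is_ellipse b l \<longleftrightarrow> l < b"

definition is_hyperbola :: "real \<Rightarrow> real \<Rightarrow> real \<Rightarrow> bool" where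
  "is_hyperbola a b l \<longleftrightarrow> b < l \<and> l < a"

text \<open>Half the gradient of the defining equation of the conic.\<close>

definition conic_normal :: "real \<Rightarrow> real \<Rightarrow> real \<Rightarrow> point \<Rightarrow> point" where
  "conic_normal a b l p = (fst p / (a - l), snd p / (b - l))"

text \<open>
  Tangency includes tangency at a point at infinity: the asymptotes of a hyperbola count as
  tangents. Otherwise no member of the family would be tangent to a line through the centre,
  and a family of rays tangent to a hyperbola would break off where a ray passes through the centre.
\<close>

definition asymptote_of_conic :: "real \<Rightarrow> real \<Rightarrow> real \<Rightarrow> point set \<Rightarrow> bool" where
  "asymptote_of_conic a b l L \<longleftrightarrow>
     (\<exists>d. d \<noteq> 0 \<and> (fst d)\<^sup>2 / (a - l) + (snd d)\<^sup>2 / (b - l) = 0 \<and> L = range (\<lambda>t. t *\<^sub>R d))"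

definition tangent_to_conic :: "real \<Rightarrow> real \<Rightarrow> real \<Rightarrow> point set \<Rightarrow> bool" where
  "tangent_to_conic a b l L \<longleftrightarrow>
     (\<exists>T \<in> conic a b l. L = {Z. (Z - T) \<bullet> conic_normal a b l T = 0}) \<or>
     asymptote_of_conic a b l L"

text \<open>
  A curvilinear quadrilateral \<open>ABCD\<close> is a closed topological disc given with a homeomorphism \<open>F\<close> from
  the unit square, whose corners \<open>(0,0), (1,0), (1,1), (0,1)\<close> go to \<open>A, B, C, D\<close>; only the
  table, the sides and the vertices are used, not the parametrization inside.
\<close>

definition unit_square :: "point set" where
  "unit_square = {0..1} \<times> {0..1}"

definition table :: "(point \<Rightarrow> point) \<Rightarrow> point set" where
  "table F = F ` unit_square"

definition side_AB :: "(point \<Rightarrow> point) \<Rightarrow> point set" where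
  "side_AB F = F ` ({0..1} \<times> {0})"

definition side_BC :: "(point \<Rightarrow> point) \<Rightarrow> point set" where
  "side_BC F = F ` ({1} \<times> {0..1})"

definition side_CD :: "(point \<Rightarrow> point) \<Rightarrow> point set" where
  "side_CD F = F ` ({0..1} \<times> {1})"

definition side_DA :: "(point \<Rightarrow> point) \<Rightarrow> point set" where
  "side_DA F = F ` ({0} \<times> {0..1})"

definition corners :: "(point \<Rightarrow> point) \<Rightarrow> point set" where
  "corners F = {F (0, 0), F (1, 0), F (1, 1), F (0, 1)}"

text \<open>
  The sides meet orthogonally at every vertex, but the angle measured inside the table could be
  three right angles instead of one. By an index count for the foliation by confocal ellipses
  (each focus has index 1/2), all four interior angles are right angles if and only if the table
  contains no focus; this is the last condition.
\<close>

definition confocal_quadrilateral ::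
    "real \<Rightarrow> real \<Rightarrow> real \<Rightarrow> real \<Rightarrow> real \<Rightarrow> real \<Rightarrow> (point \<Rightarrow> point) \<Rightarrow> bool" where
  "confocal_quadrilateral a b lAB lBC lCD lDA F \<longleftrightarrow>
     continuous_on unit_square F \<and> inj_on F unit_square \<and>
     side_AB F \<subseteq> conic a b lAB \<and> side_BC F \<subseteq> conic a b lBC \<and>
     side_CD F \<subseteq> conic a b lCD \<and> side_DA F \<subseteq> conic a b lDA \<and>
     (is_ellipse b lAB \<and> is_ellipse b lCD \<and> is_hyperbola a b lBC \<and> is_hyperbola a b lDA \<or>
      is_hyperbola a b lAB \<and> is_hyperbola a b lCD \<and> is_ellipse b lBC \<and> is_ellipse b lDA) \<and>
     (sqrt (a - b), 0) \<notin> table F \<and> (- sqrt (a - b), 0) \<notin> table F"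

text \<open>
  A ray from \<open>P\<close> hits the conic \<open>l\<close> at \<open>Q\<close> and leaves towards \<open>R\<close>: the unit direction vector is
  reflected in the tangent line of the conic at \<open>Q\<close>.
\<close>

definition reflects_at :: "real \<Rightarrow> real \<Rightarrow> real \<Rightarrow> point \<Rightarrow> point \<Rightarrow> point \<Rightarrow> bool" where
  "reflects_at a b l P Q R \<longleftrightarrow> P \<noteq> Q \<and> R \<noteq> Q \<and>
     (let n = conic_normal a b l Q; d = sgn (Q - P)
      in sgn (R - Q) = d - (2 * (d \<bullet> n) / (n \<bullet> n)) *\<^sub>R n)"

text \<open>
  The trajectories without vertices at corners. The remaining ones, the diagonals traversed back
  and forth, are the vertex quadruples \<open>(B, B, D, D)\<close> and \<open>(A, C, C, A)\<close>.
\<close>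

definition billiard_trajectory ::
    "real \<Rightarrow> real \<Rightarrow> real \<Rightarrow> real \<Rightarrow> real \<Rightarrow> real \<Rightarrow> (point \<Rightarrow> point) \<Rightarrow>
     point \<Rightarrow> point \<Rightarrow> point \<Rightarrow> point \<Rightarrow> bool" where
  "billiard_trajectory a b lAB lBC lCD lDA F P Q R S \<longleftrightarrow>
     P \<in> side_AB F - corners F \<and> Q \<in> side_BC F - corners F \<and>
     R \<in> side_CD F - corners F \<and> S \<in> side_DA F - corners F \<and>
     closed_segment P Q \<subseteq> table F \<and> closed_segment Q R \<subseteq> table F \<and>
     closed_segment R S \<subseteq> table F \<and> closed_segment S P \<subseteq> table F \<and>
     reflects_at a b lAB S P Q \<and> reflects_at a b lBC P Q R \<and>
     reflects_at a b lCD Q R S \<and> reflects_at a b lDA R S P"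

definition rays_tangent ::
    "real \<Rightarrow> real \<Rightarrow> real \<Rightarrow> point \<Rightarrow> point \<Rightarrow> point \<Rightarrow> point \<Rightarrow> bool" where
  "rays_tangent a b m P Q R S \<longleftrightarrow>
     tangent_to_conic a b m (affine hull {P, Q}) \<and> tangent_to_conic a b m (affine hull {Q, R}) \<and>
     tangent_to_conic a b m (affine hull {R, S}) \<and> tangent_to_conic a b m (affine hull {S, P})"

definition perimeter :: "point \<Rightarrow> point \<Rightarrow> point \<Rightarrow> point \<Rightarrow> real" where
  "perimeter P Q R S = dist P Q + dist Q R + dist R S + dist S P"

end

theory Submission
  imports Defs
begin

text \<open>
  In elliptic coordinates \<open>z = c cosh (u + i v)\<close>, \<open>c\<^sup>2 = a - b\<close>, the table is a rectangle. A line tangent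
  to the conic \<open>m\<close> satisfies \<open>u' = p\<^sub>u / h\<close> and \<open>v' = p\<^sub>v / h\<close>, where
  \<open>p\<^sub>u\<^sup>2 = c\<^sup>2 cosh\<^sup>2 u - (a - m)\<close>, \<open>p\<^sub>v\<^sup>2 = (a - m) - c\<^sup>2 cos\<^sup>2 v\<close> and \<open>h = p\<^sub>u\<^sup>2 + p\<^sub>v\<^sup>2\<close>. Parametrizing
  \<open>u\<close> and \<open>v\<close> separately by the time \<open>\<integral> ds / h\<close> along the given diagonal \<open>BD\<close> turns the
  rectangle into a square \<open>[0, T]\<^sup>2\<close> in which the lines tangent to \<open>m\<close> are the lines of slope \<open>\<plusminus>1\<close> and
  the reflections change the sign of one component of the velocity. The trajectories are thus the
  inscribed rectangles with sides parallel to the diagonals of the square. Since \<open>ds = h dt\<close>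
  separates as well, each of them has length \<open>2 \<integral> p\<^sub>u\<^sup>2 + 2 \<integral> p\<^sub>v\<^sup>2\<close>, the integrals being over \<open>[0, T]\<close>.
\<close>

section \<open>Elliptic coordinates\<close>

text \<open>One diagonal yields all trajectories because the equations
  \<open>u'' = c^2 cosh u sinh u\<close> and \<open>v'' = c^2 cos v sin v\<close> are uncoupled: the
  two coordinate motions of BD may be evaluated at independent times, and every such combination,
  also with a motion reversed, is again a straight line. As BD joins opposite corners, it supplies
  both motions between the two values at the sides, and no existence theorem for differential
  equations is needed. The second-order form avoids dividing by momenta, which vanish where a line
  touches the caustic. If a coordinate took a boundary value in the interior of BD, it would have
  two critical points; this is excluded because the product of the two momenta is affine in the arc
  length and not identically zero. That the table is a rectangle is itself a topological statement:
  \<open>cosh\<close> is branched over the foci, so their absence lets \<open>F\<close> be lifted,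
  the sides become straight, and invariance of domain shows that the lifted image fills the
  rectangle.\<close>

lemma Re_cosh: "Re (cosh w) = cosh (Re w) * cos (Im w)"
  and Im_cosh: "Im (cosh w) = sinh (Re w) * sin (Im w)"
  and Re_sinh: "Re (sinh w) = sinh (Re w) * cos (Im w)"
  and Im_sinh: "Im (sinh w) = cosh (Re w) * sin (Im w)"
  by (simp_all add: cosh_field_def sinh_field_def Re_exp Im_exp field_simps)

lemma cosh_cnj: "cosh (cnj w) = cnj (cosh w)"
  and sinh_cnj: "sinh (cnj w) = cnj (sinh w)"
  by (simp_all add: complex_eq_iff Re_cosh Im_cosh Re_sinh Im_sinh)

lemma cmod_sinh_squared: "(cmod (sinh w))\<^sup>2 = (cosh (Re w))\<^sup>2 - (cos (Im w))\<^sup>2"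
proof -
  have "(cmod (sinh w))\<^sup>2 = (sinh (Re w))\<^sup>2 * (cos (Im w))\<^sup>2 + (cosh (Re w))\<^sup>2 * (sin (Im w))\<^sup>2"
    by (simp add: cmod_power2 Re_sinh Im_sinh power_mult_distrib)
  then show ?thesis
    by (simp add: sinh_square_eq sin_squared_eq algebra_simps)
qed

text \<open>Product-to-sum: for \<open>w = u + i v\<close> the value is half of
  \<open>sinh (2 u) + i sin (2 v)\<close>. This splitting is what uncouples the equations of
  motion.\<close>

lemma sinh_times_cosh_cnj:
  "sinh w * cosh (cnj w) = Complex (cosh (Re w) * sinh (Re w)) (cos (Im w) * sin (Im w))"
proof -
  have "sinh (Re w) * cos (Im w) * (cosh (Re w) * cos (Im w)) +
      cosh (Re w) * sin (Im w) * (sinh (Re w) * sin (Im w)) =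
      cosh (Re w) * sinh (Re w) * ((cos (Im w))\<^sup>2 + (sin (Im w))\<^sup>2)"
    "cosh (Re w) * sin (Im w) * (cosh (Re w) * cos (Im w)) -
      sinh (Re w) * cos (Im w) * (sinh (Re w) * sin (Im w)) =
      ((cosh (Re w))\<^sup>2 - (sinh (Re w))\<^sup>2) * (cos (Im w) * sin (Im w))"
    by algebra+
  then show ?thesis
    by (simp add: complex_eq_iff Re_cosh Im_cosh Re_sinh Im_sinh hyperbolic_pythagoras)
qed

text \<open>Joachimsthal's integral: the bracket is constant along the line through \<open>c cosh w\<close> with direction
  \<open>e\<close>.\<close>

lemma momentum_of_direction:
  assumes "cmod e = 1"
  shows "(Re (of_real c * e * sinh (cnj w)))\<^sup>2 =
      c\<^sup>2 * (cosh (Re w))\<^sup>2 - (c\<^sup>2 * (Re e)\<^sup>2 + (Im (e * cnj (of_real c * cosh w)))\<^sup>2)"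
    and "(Im (of_real c * e * sinh (cnj w)))\<^sup>2 =
      (c\<^sup>2 * (Re e)\<^sup>2 + (Im (e * cnj (of_real c * cosh w)))\<^sup>2) - c\<^sup>2 * (cos (Im w))\<^sup>2"
proof -
  have unit: "(Re e)\<^sup>2 + (Im e)\<^sup>2 = 1"
    using assms by (simp add: cmod_power2[symmetric])
  have cross: "Im (e * cnj (of_real c * cosh w)) =
      c * (Im e * (cosh (Re w) * cos (Im w)) - Re e * (sinh (Re w) * sin (Im w)))"
    by (simp add: Re_cosh Im_cosh algebra_simps)
  have Re: "Re (of_real c * e * sinh (cnj w)) =
      c * (Re e * (sinh (Re w) * cos (Im w)) + Im e * (cosh (Re w) * sin (Im w)))"
    and Im: "Im (of_real c * e * sinh (cnj w)) =
      c * (Im e * (sinh (Re w) * cos (Im w)) - Re e * (cosh (Re w) * sin (Im w)))"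
    by (simp_all add: Re_sinh Im_sinh sinh_cnj algebra_simps)
  have hyp: "(cosh (Re w))\<^sup>2 = (sinh (Re w))\<^sup>2 + 1" "(cos (Im w))\<^sup>2 = 1 - (sin (Im w))\<^sup>2"
    by (simp_all add: cosh_square_eq cos_squared_eq)
  show "(Re (of_real c * e * sinh (cnj w)))\<^sup>2 =
      c\<^sup>2 * (cosh (Re w))\<^sup>2 - (c\<^sup>2 * (Re e)\<^sup>2 + (Im (e * cnj (of_real c * cosh w)))\<^sup>2)"
    unfolding Re cross using hyp unit by algebra
  show "(Im (of_real c * e * sinh (cnj w)))\<^sup>2 =
      (c\<^sup>2 * (Re e)\<^sup>2 + (Im (e * cnj (of_real c * cosh w)))\<^sup>2) - c\<^sup>2 * (cos (Im w))\<^sup>2"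
    unfolding Im cross using hyp unit by algebra
qed

lemma constant_on_interval:
  fixes f :: "real \<Rightarrow> 'a::banach"
  assumes "continuous_on {a..b} f"
    and "\<And>t. a < t \<Longrightarrow> t < b \<Longrightarrow> (f has_vector_derivative 0) (at t)" and "s \<in> {a..b}"
  shows "f s = f a"
proof (rule has_derivative_zero_unique_strong_interval[of "{a, b}" a b])
  show "(f has_derivative (\<lambda>h. 0)) (at x within {a..b})" if "x \<in> {a..b} - {a, b}" for x
    using assms(2)[of x] that
    by (auto simp: has_vector_derivative_def intro: has_derivative_at_withinI)
qed (use assms in auto)

section \<open>Straight lines in separated coordinates\<close>

text \<open>
  \<open>pu\<close> and \<open>pv\<close> are derivatives rather than square roots, so that they may vanish, at the end points,
  where a side of the table lies on the caustic.
\<close>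

locale separated_flow =
  fixes c k T :: real and U V pu pv :: "real \<Rightarrow> real"
  assumes c_pos: "c > 0" and T_pos: "T > 0"
    and continuous: "continuous_on {0..T} U" "continuous_on {0..T} V"
      "continuous_on {0..T} pu" "continuous_on {0..T} pv"
    and U_deriv: "\<And>x. 0 < x \<Longrightarrow> x < T \<Longrightarrow> (U has_real_derivative pu x) (at x)"
    and V_deriv: "\<And>y. 0 < y \<Longrightarrow> y < T \<Longrightarrow> (V has_real_derivative pv y) (at y)"
    and pu_deriv: "\<And>x. 0 < x \<Longrightarrow> x < T \<Longrightarrow>
      (pu has_real_derivative c\<^sup>2 * (cosh (U x) * sinh (U x))) (at x)"
    and pv_deriv: "\<And>y. 0 < y \<Longrightarrow> y < T \<Longrightarrow>
      (pv has_real_derivative c\<^sup>2 * (cos (V y) * sin (V y))) (at y)"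
    and pu_squared: "\<And>x. x \<in> {0..T} \<Longrightarrow> (pu x)\<^sup>2 = c\<^sup>2 * (cosh (U x))\<^sup>2 - k"
    and pv_squared: "\<And>y. y \<in> {0..T} \<Longrightarrow> (pv y)\<^sup>2 = k - c\<^sup>2 * (cos (V y))\<^sup>2"
    and nonfocal: "\<And>x y. x \<in> {0..T} \<Longrightarrow> y \<in> {0..T} \<Longrightarrow> sinh (Complex (U x) (V y)) \<noteq> 0"
begin

definition node :: "real \<Rightarrow> real \<Rightarrow> complex" where
  "node x y = of_real c * cosh (Complex (U x) (V y))"

text \<open>The unit tangent vector. The velocity of \<open>node\<close> is \<open>c sinh w\<close>
  times the coordinate velocity with components \<open>\<sigma> * pu x\<close> and
  \<open>\<tau> * pv y\<close>, and the speed is \<open>c^2 |sinh w|^2\<close>; the quotient leaves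
  the conjugate of \<open>sinh w\<close> in the denominator.\<close>

definition dir :: "real \<Rightarrow> real \<Rightarrow> real \<Rightarrow> real \<Rightarrow> complex" where
  "dir \<sigma> \<tau> x y = Complex (\<sigma> * pu x) (\<tau> * pv y) / (of_real c * sinh (cnj (Complex (U x) (V y))))"

text \<open>\<open>K\<close> and \<open>N\<close> are the contributions of the two coordinates to
  the arc length, since the speed is \<open>pu^2 + pv^2\<close>.\<close>

definition K :: "real \<Rightarrow> real" where
  "K x = integral {0..x} (\<lambda>t. (pu t)\<^sup>2)"

definition N :: "real \<Rightarrow> real" where
  "N y = integral {0..y} (\<lambda>t. (pv t)\<^sup>2)"

lemma K_deriv: assumes "0 < x" "x < T" shows "(K has_real_derivative (pu x)\<^sup>2) (at x)"
proof -
  have "(K has_real_derivative (pu x)\<^sup>2) (at x within {0..T})"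
    unfolding K_def using continuous assms
    by (intro integral_has_real_derivative) (auto intro!: continuous_intros)
  then show ?thesis using assms at_within_Icc_at by metis
qed

lemma N_deriv: assumes "0 < x" "x < T" shows "(N has_real_derivative (pv x)\<^sup>2) (at x)"
proof -
  have "(N has_real_derivative (pv x)\<^sup>2) (at x within {0..T})"
    unfolding N_def using continuous assms
    by (intro integral_has_real_derivative) (auto intro!: continuous_intros)
  then show ?thesis using assms at_within_Icc_at by metis
qed

lemma K_continuous: "continuous_on {0..T} K"
  unfolding K_def using continuous
  by (intro indefinite_integral_continuous_1 integrable_continuous_real continuous_intros)

lemma N_continuous: "continuous_on {0..T} N"
  unfolding N_def using continuous
  by (intro indefinite_integral_continuous_1 integrable_continuous_real continuous_intros)

text \<open>The constant \<open>k\<close> cancels. The speed at a point is therefore the conformal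
  factor of the coordinates, the same for all choices of signs.\<close>

lemma momentum_squared:
  assumes "x \<in> {0..T}" "y \<in> {0..T}"
  shows "(pu x)\<^sup>2 + (pv y)\<^sup>2 = (c * cmod (sinh (Complex (U x) (V y))))\<^sup>2"
  using assms by (simp add: pu_squared pv_squared power_mult_distrib cmod_sinh_squared algebra_simps)

lemma momentum_squared_pos:
  assumes "x \<in> {0..T}" "y \<in> {0..T}"
  shows "(pu x)\<^sup>2 + (pv y)\<^sup>2 > 0"
  using momentum_squared[OF assms] nonfocal[OF assms] c_pos by simp

lemma norm_dir:
  assumes "x \<in> {0..T}" "y \<in> {0..T}" "\<sigma>\<^sup>2 = 1" "\<tau>\<^sup>2 = 1"
  shows "cmod (dir \<sigma> \<tau> x y) = 1"
proof -
  have "(cmod (Complex (\<sigma> * pu x) (\<tau> * pv y)))\<^sup>2 = (c * cmod (sinh (Complex (U x) (V y))))\<^sup>2"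
    using momentum_squared[OF assms(1,2)] assms(3,4) by (simp add: cmod_power2 power_mult_distrib)
  then have "cmod (Complex (\<sigma> * pu x) (\<tau> * pv y)) = c * cmod (sinh (Complex (U x) (V y)))"
    using c_pos by (simp add: power2_eq_iff_nonneg)
  moreover have "c * cmod (sinh (Complex (U x) (V y))) \<noteq> 0"
    using nonfocal[OF assms(1,2)] c_pos by simp
  ultimately show ?thesis
    using c_pos unfolding dir_def by (simp add: norm_divide norm_mult sinh_cnj)
qed

lemma dir_times_sinh:
  assumes "x \<in> {0..T}" "y \<in> {0..T}" "\<sigma>\<^sup>2 = 1" "\<tau>\<^sup>2 = 1"
  shows "dir \<sigma> \<tau> x y * of_real ((pu x)\<^sup>2 + (pv y)\<^sup>2) =
    of_real c * sinh (Complex (U x) (V y)) * Complex (\<sigma> * pu x) (\<tau> * pv y)"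
proof -
  let ?w = "Complex (U x) (V y)"
  have "of_real ((pu x)\<^sup>2 + (pv y)\<^sup>2) = (of_real c)\<^sup>2 * (sinh ?w * sinh (cnj ?w))"
    using complex_norm_square[of "sinh ?w"]
    by (simp only: momentum_squared[OF assms(1,2)] sinh_cnj power_mult_distrib of_real_mult of_real_power)
  then show ?thesis
    using nonfocal[OF assms(1,2)] c_pos unfolding dir_def
    by (simp add: sinh_cnj power2_eq_square)
qed

text \<open>With \<open>\<omega>' = c^2 sinh w cosh (cnj w)\<close> and
  \<open>\<omega> cnj \<omega> = c^2 sinh w sinh (cnj w)\<close> the two terms in the derivative of
  \<open>\<omega> / (c sinh (cnj w))\<close> cancel, so the path is straight. The signs drop out of
  \<open>\<omega>'\<close> because each enters twice, through the definition of
  \<open>\<omega>\<close> and through the chain rule.\<close>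

lemma path_deriv:
  assumes \<sigma>: "\<sigma>\<^sup>2 = 1" "\<tau>\<^sup>2 = 1"
    and x: "0 < x0 + \<sigma> * t" "x0 + \<sigma> * t < T" and y: "0 < y0 + \<tau> * t" "y0 + \<tau> * t < T"
  shows "((\<lambda>t. dir \<sigma> \<tau> (x0 + \<sigma> * t) (y0 + \<tau> * t)) has_vector_derivative 0) (at t)"
    and "((\<lambda>t. node (x0 + \<sigma> * t) (y0 + \<tau> * t)) has_vector_derivative
      of_real ((pu (x0 + \<sigma> * t))\<^sup>2 + (pv (y0 + \<tau> * t))\<^sup>2) *
        dir \<sigma> \<tau> (x0 + \<sigma> * t) (y0 + \<tau> * t)) (at t)"
proof -
  let ?x = "x0 + \<sigma> * t" and ?y = "y0 + \<tau> * t"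
  define w where "w t = Complex (U (x0 + \<sigma> * t)) (V (y0 + \<tau> * t))" for t
  define \<omega> where "\<omega> t = Complex (\<sigma> * pu (x0 + \<sigma> * t)) (\<tau> * pv (y0 + \<tau> * t))" for t
  have lin: "((\<lambda>t. x0 + \<sigma> * t) has_real_derivative \<sigma>) (at t)"
    "((\<lambda>t. y0 + \<tau> * t) has_real_derivative \<tau>) (at t)"
    by (auto intro!: derivative_eq_intros)
  have vecI: "((\<lambda>t. Complex (f t) (g t)) has_vector_derivative Complex f' g') (at t)"
    if "(f has_real_derivative f') (at t)" "(g has_real_derivative g') (at t)" for f g f' g'
    using that by (simp add: has_vector_derivative_complex_iff)
  have w': "(w has_vector_derivative \<omega> t) (at t)"
    unfolding w_def \<omega>_def
    using DERIV_chain2[OF U_deriv[OF x] lin(1)] DERIV_chain2[OF V_deriv[OF y] lin(2)]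
    by (intro vecI) (simp_all add: mult.commute)
  have "(\<omega> has_vector_derivative Complex (\<sigma> * (c\<^sup>2 * (cosh (U ?x) * sinh (U ?x)) * \<sigma>))
       (\<tau> * (c\<^sup>2 * (cos (V ?y) * sin (V ?y)) * \<tau>))) (at t)"
    unfolding \<omega>_def
    using DERIV_cmult[OF DERIV_chain2[OF pu_deriv[OF x] lin(1)]]
      DERIV_cmult[OF DERIV_chain2[OF pv_deriv[OF y] lin(2)]]
    by (intro vecI) auto
  moreover have "Complex (\<sigma> * (c\<^sup>2 * (cosh (U ?x) * sinh (U ?x)) * \<sigma>))
       (\<tau> * (c\<^sup>2 * (cos (V ?y) * sin (V ?y)) * \<tau>)) = of_real c^2 * (sinh (w t) * cosh (cnj (w t)))"
  proof -
    have "\<sigma> * (z * \<sigma>) = z" "\<tau> * (z * \<tau>) = z" for z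
      using \<sigma> by (simp_all add: power2_eq_square algebra_simps)
    then show ?thesis
      unfolding sinh_times_cosh_cnj by (simp add: w_def complex_eq_iff flip: of_real_power)
  qed
  ultimately have \<omega>': "(\<omega> has_vector_derivative of_real c^2 * (sinh (w t) * cosh (cnj (w t)))) (at t)"
    by simp
  have cw': "((\<lambda>t. cnj (w t)) has_vector_derivative cnj (\<omega> t)) (at t)"
    using bounded_linear.has_vector_derivative[OF bounded_linear_cnj w'] .
  have nz: "sinh (w t) \<noteq> 0" "sinh (cnj (w t)) \<noteq> 0"
    using nonfocal[of ?x ?y] x y by (auto simp: w_def sinh_cnj)
  have sw: "((\<lambda>t. 1 / (of_real c * sinh (cnj (w t)))) has_vector_derivative
      cnj (\<omega> t) * (- (cosh (cnj (w t)) / (of_real c * (sinh (cnj (w t)))^2)))) (at t)"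
  proof -
    have "((\<lambda>z. 1 / (of_real c * sinh z)) has_field_derivative
        - (cosh (cnj (w t)) / (of_real c * (sinh (cnj (w t)))^2))) (at (cnj (w t)))"
      using nz c_pos by (auto intro!: derivative_eq_intros simp: power2_eq_square field_simps)
    from field_vector_diff_chain_at[OF cw' this] show ?thesis by (simp add: o_def)
  qed
  have \<omega>2: "\<omega> t * cnj (\<omega> t) = of_real c^2 * (sinh (w t) * sinh (cnj (w t)))"
  proof -
    have "(cmod (\<omega> t))\<^sup>2 = (c * cmod (sinh (w t)))\<^sup>2"
      using momentum_squared[of ?x ?y] x y \<sigma>
      by (simp add: \<omega>_def w_def cmod_power2 power_mult_distrib)
    then show ?thesis
      by (simp only: complex_norm_square[symmetric] sinh_cnj of_real_mult of_real_power power_mult_distrib)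
  qed
  have "((\<lambda>t. \<omega> t * (1 / (of_real c * sinh (cnj (w t))))) has_vector_derivative
      \<omega> t * (cnj (\<omega> t) * (- (cosh (cnj (w t)) / (of_real c * (sinh (cnj (w t)))^2)))) +
      of_real c^2 * (sinh (w t) * cosh (cnj (w t))) * (1 / (of_real c * sinh (cnj (w t))))) (at t)"
    by (rule has_vector_derivative_mult[OF \<omega>' sw])
  moreover have "\<omega> t * (cnj (\<omega> t) * (- (cosh (cnj (w t)) / (of_real c * (sinh (cnj (w t)))^2)))) +
      of_real c^2 * (sinh (w t) * cosh (cnj (w t))) * (1 / (of_real c * sinh (cnj (w t)))) = 0"
    unfolding mult.assoc[symmetric] \<omega>2 using nz c_pos by (simp add: field_simps power2_eq_square)
  ultimately show "((\<lambda>t. dir \<sigma> \<tau> (x0 + \<sigma> * t) (y0 + \<tau> * t)) has_vector_derivative 0) (at t)"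
    unfolding dir_def by (simp add: \<omega>_def w_def)
  have "((\<lambda>t. of_real c * cosh (w t)) has_vector_derivative \<omega> t * (of_real c * sinh (w t))) (at t)"
  proof -
    have "((\<lambda>z. of_real c * cosh z) has_field_derivative of_real c * sinh (w t)) (at (w t))"
      by (auto intro!: derivative_eq_intros)
    from field_vector_diff_chain_at[OF w' this] show ?thesis by (simp add: o_def)
  qed
  moreover have "\<omega> t * (of_real c * sinh (w t)) =
      of_real ((pu ?x)\<^sup>2 + (pv ?y)\<^sup>2) * dir \<sigma> \<tau> ?x ?y"
    using dir_times_sinh[of ?x ?y, OF _ _ \<sigma>] x y unfolding \<omega>_def w_def by (simp add: mult_ac)
  ultimately show "((\<lambda>t. node (x0 + \<sigma> * t) (y0 + \<tau> * t)) has_vector_derivative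
      of_real ((pu ?x)\<^sup>2 + (pv ?y)\<^sup>2) * dir \<sigma> \<tau> ?x ?y) (at t)"
    unfolding node_def w_def by simp
qed

lemma path_continuous:
  assumes "\<And>t. t \<in> {0..d} \<Longrightarrow> x0 + \<sigma> * t \<in> {0..T}" "\<And>t. t \<in> {0..d} \<Longrightarrow> y0 + \<tau> * t \<in> {0..T}"
  shows "continuous_on {0..d} (\<lambda>t. U (x0 + \<sigma> * t))" "continuous_on {0..d} (\<lambda>t. V (y0 + \<tau> * t))"
    "continuous_on {0..d} (\<lambda>t. pu (x0 + \<sigma> * t))" "continuous_on {0..d} (\<lambda>t. pv (y0 + \<tau> * t))"
    "continuous_on {0..d} (\<lambda>t. K (x0 + \<sigma> * t))" "continuous_on {0..d} (\<lambda>t. N (y0 + \<tau> * t))"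
    "continuous_on {0..d} (\<lambda>t. node (x0 + \<sigma> * t) (y0 + \<tau> * t))"
    "continuous_on {0..d} (\<lambda>t. dir \<sigma> \<tau> (x0 + \<sigma> * t) (y0 + \<tau> * t))"
proof -
  have *: "continuous_on {0..d} (\<lambda>t. f (x0 + \<sigma> * t))" "continuous_on {0..d} (\<lambda>t. f (y0 + \<tau> * t))"
    if "continuous_on {0..T} f" for f :: "real \<Rightarrow> real"
    by (rule continuous_on_compose2[OF that]; use assms in \<open>auto intro!: continuous_intros\<close>)+
  show **: "continuous_on {0..d} (\<lambda>t. U (x0 + \<sigma> * t))" "continuous_on {0..d} (\<lambda>t. V (y0 + \<tau> * t))"
    "continuous_on {0..d} (\<lambda>t. pu (x0 + \<sigma> * t))" "continuous_on {0..d} (\<lambda>t. pv (y0 + \<tau> * t))"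
    and "continuous_on {0..d} (\<lambda>t. K (x0 + \<sigma> * t))" "continuous_on {0..d} (\<lambda>t. N (y0 + \<tau> * t))"
    by (intro * continuous K_continuous N_continuous)+
  show "continuous_on {0..d} (\<lambda>t. node (x0 + \<sigma> * t) (y0 + \<tau> * t))"
    unfolding node_def Complex_eq by (intro continuous_intros **)
  have "of_real c * sinh (cnj (Complex (U (x0 + \<sigma> * t)) (V (y0 + \<tau> * t)))) \<noteq> 0" if "t \<in> {0..d}" for t
    using c_pos nonfocal assms[OF that] by (simp add: sinh_cnj)
  then show "continuous_on {0..d} (\<lambda>t. dir \<sigma> \<tau> (x0 + \<sigma> * t) (y0 + \<tau> * t))"
    unfolding dir_def Complex_eq by (intro continuous_intros **) auto
qed

text \<open>The signs make both coordinates contribute nonnegatively along a ray, whichever way each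
  of them is traversed.\<close>

definition travel :: "real \<Rightarrow> real \<Rightarrow> real \<Rightarrow> real \<Rightarrow> real \<Rightarrow> real \<Rightarrow> real" where
  "travel \<sigma> \<tau> x0 y0 x1 y1 = \<sigma> * (K x1 - K x0) + \<tau> * (N y1 - N y0)"

definition ray :: "real \<Rightarrow> real \<Rightarrow> real \<Rightarrow> real \<Rightarrow> real \<Rightarrow> real \<Rightarrow> real \<Rightarrow> bool" where
  "ray \<sigma> \<tau> d x0 y0 x1 y1 \<longleftrightarrow> \<sigma> \<in> {1, -1} \<and> \<tau> \<in> {1, -1} \<and> d \<ge> 0 \<and>
    {x0, y0, x1, y1} \<subseteq> {0..T} \<and> x1 = x0 + \<sigma> * d \<and> y1 = y0 + \<tau> * d"

context
  fixes \<sigma> \<tau> d x0 y0 x1 y1 :: real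
  assumes ray: "ray \<sigma> \<tau> d x0 y0 x1 y1"
begin

lemma signs: "\<sigma> \<in> {1, -1}" "\<tau> \<in> {1, -1}" and d: "d \<ge> 0"
  and square: "x0 \<in> {0..T}" "y0 \<in> {0..T}" "x1 \<in> {0..T}" "y1 \<in> {0..T}"
  and ends: "x1 = x0 + \<sigma> * d" "y1 = y0 + \<tau> * d"
  using ray by (auto simp: ray_def)

lemma path_in_square:
  assumes "t \<in> {0..d}"
  shows "x0 + \<sigma> * t \<in> {0..T}" "y0 + \<tau> * t \<in> {0..T}"
  using assms signs square ends by auto

lemma path_in_open_square:
  assumes "0 < t" "t < d"
  shows "0 < x0 + \<sigma> * t" "x0 + \<sigma> * t < T" "0 < y0 + \<tau> * t" "y0 + \<tau> * t < T"
  using assms signs square ends by auto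

lemma signs_squared: "\<sigma>\<^sup>2 = 1" "\<tau>\<^sup>2 = 1"
  using signs by auto

lemma travel_path_deriv:
  assumes "0 < t" "t < d"
  shows "((\<lambda>t. travel \<sigma> \<tau> x0 y0 (x0 + \<sigma> * t) (y0 + \<tau> * t)) has_real_derivative
    (pu (x0 + \<sigma> * t))\<^sup>2 + (pv (y0 + \<tau> * t))\<^sup>2) (at t)"
proof -
  have lin: "((\<lambda>t. x0 + \<sigma> * t) has_real_derivative \<sigma>) (at t)"
    "((\<lambda>t. y0 + \<tau> * t) has_real_derivative \<tau>) (at t)"
    by (auto intro!: derivative_eq_intros)
  note op = path_in_open_square[OF assms]
  note DERIV_chain2[OF K_deriv lin(1)] DERIV_chain2[OF N_deriv lin(2)]
  then have "((\<lambda>t. travel \<sigma> \<tau> x0 y0 (x0 + \<sigma> * t) (y0 + \<tau> * t)) has_real_derivative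
      \<sigma> * ((pu (x0 + \<sigma> * t))\<^sup>2 * \<sigma>) + \<tau> * ((pv (y0 + \<tau> * t))\<^sup>2 * \<tau>)) (at t)"
    unfolding travel_def using op by (auto intro!: derivative_eq_intros)
  then show ?thesis
    using signs by (auto simp: algebra_simps)
qed

lemma travel_path_continuous:
  "continuous_on {0..d} (\<lambda>t. travel \<sigma> \<tau> x0 y0 (x0 + \<sigma> * t) (y0 + \<tau> * t))"
  unfolding travel_def
  by (intro continuous_intros path_continuous(5,6)[OF path_in_square, where d = d]) auto

lemma dir_path:
  assumes "t \<in> {0..d}"
  shows "dir \<sigma> \<tau> (x0 + \<sigma> * t) (y0 + \<tau> * t) = dir \<sigma> \<tau> x0 y0"
  using constant_on_interval[OF path_continuous(8)[OF path_in_square]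
      path_deriv(1)[OF signs_squared path_in_open_square] assms] by simp

lemma node_path:
  assumes "t \<in> {0..d}"
  shows "node (x0 + \<sigma> * t) (y0 + \<tau> * t) =
    node x0 y0 + of_real (travel \<sigma> \<tau> x0 y0 (x0 + \<sigma> * t) (y0 + \<tau> * t)) * dir \<sigma> \<tau> x0 y0"
proof -
  let ?f = "\<lambda>t. node (x0 + \<sigma> * t) (y0 + \<tau> * t) -
      of_real (travel \<sigma> \<tau> x0 y0 (x0 + \<sigma> * t) (y0 + \<tau> * t)) * dir \<sigma> \<tau> x0 y0"
  have "?f t = ?f 0"
  proof (rule constant_on_interval[of 0 d])
    show "continuous_on {0..d} ?f"
      by (intro continuous_intros travel_path_continuous path_continuous(7)[OF path_in_square])
    show "(?f has_vector_derivative 0) (at s)" if s: "0 < s" "s < d" for s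
    proof -
      have "((\<lambda>t. of_real (travel \<sigma> \<tau> x0 y0 (x0 + \<sigma> * t) (y0 + \<tau> * t)) * dir \<sigma> \<tau> x0 y0)
          has_vector_derivative of_real ((pu (x0 + \<sigma> * s))\<^sup>2 + (pv (y0 + \<tau> * s))\<^sup>2) * dir \<sigma> \<tau> x0 y0) (at s)"
        using has_vector_derivative_mult_left[OF has_vector_derivative_of_real[OF travel_path_deriv[OF s]]] .
      from has_vector_derivative_diff[OF path_deriv(2)[OF signs_squared path_in_open_square[OF s]] this]
      show ?thesis using dir_path[of s] s by simp
    qed
  qed (use assms in auto)
  then show ?thesis by (simp add: travel_def algebra_simps)
qed

lemma dir_end: "dir \<sigma> \<tau> x1 y1 = dir \<sigma> \<tau> x0 y0"
  using dir_path[of d] d ends by simp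

lemma node_end: "node x1 y1 = node x0 y0 + of_real (travel \<sigma> \<tau> x0 y0 x1 y1) * dir \<sigma> \<tau> x0 y0"
  using node_path[of d] d ends by simp

lemma travel_pos: assumes "d > 0" shows "travel \<sigma> \<tau> x0 y0 x1 y1 > 0"
proof -
  have "travel \<sigma> \<tau> x0 y0 (x0 + \<sigma> * 0) (y0 + \<tau> * 0) < travel \<sigma> \<tau> x0 y0 (x0 + \<sigma> * d) (y0 + \<tau> * d)"
  proof (rule DERIV_pos_imp_increasing_open[OF assms _ travel_path_continuous])
    show "\<exists>y. ((\<lambda>t. travel \<sigma> \<tau> x0 y0 (x0 + \<sigma> * t) (y0 + \<tau> * t)) has_real_derivative y) (at t) \<and> 0 < y"
      if "0 < t" "t < d" for t
      using travel_path_deriv[OF that] momentum_squared_pos path_in_square[of t] that by fastforce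
  qed
  then show ?thesis using ends by (simp add: travel_def)
qed

lemma travel_nonneg: "travel \<sigma> \<tau> x0 y0 x1 y1 \<ge> 0"
  using travel_pos d ends by (cases "d = 0") (auto simp: travel_def)

lemma dist_node: "dist (node x0 y0) (node x1 y1) = travel \<sigma> \<tau> x0 y0 x1 y1"
  using travel_nonneg norm_dir[OF square(1,2) signs_squared]
  by (simp add: node_end dist_norm norm_mult)

text \<open>The length travelled takes every value between 0 and the total length, so the path
  covers the whole segment. Chords thus stay in the table although it need not be convex.\<close>

lemma segment_subset:
  "closed_segment (node x0 y0) (node x1 y1) \<subseteq> (\<lambda>(x, y). node x y) ` ({0..T} \<times> {0..T})"
proof
  fix z assume "z \<in> closed_segment (node x0 y0) (node x1 y1)"
  then obtain s where s: "0 \<le> s" "s \<le> 1" "z = (1 - s) *\<^sub>R node x0 y0 + s *\<^sub>R node x1 y1"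
    by (auto simp: in_segment)
  let ?g = "\<lambda>t. travel \<sigma> \<tau> x0 y0 (x0 + \<sigma> * t) (y0 + \<tau> * t)"
  have "\<exists>t\<ge>0. t \<le> d \<and> ?g t = s * ?g d"
    using s travel_nonneg ends d
    by (intro IVT' travel_path_continuous) (auto simp: travel_def mult_left_le_one_le)
  then obtain t where t: "t \<in> {0..d}" "?g t = s * ?g d" by auto
  have "z = node (x0 + \<sigma> * t) (y0 + \<tau> * t)"
    unfolding node_path[OF t(1)] t(2) s(3) node_end using ends
    by (simp add: scaleR_conv_of_real algebra_simps)
  then show "z \<in> (\<lambda>(x, y). node x y) ` ({0..T} \<times> {0..T})"
    using path_in_square[OF t(1)] by force
qed

end

text \<open>Comparing \<open>pu_squared\<close> with Joachimsthal's integral shows that its value is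
  \<open>k\<close> on every ray, for all four choices of signs; hence all rays share one
  caustic.\<close>

lemma direction_caustic:
  assumes "x \<in> {0..T}" "y \<in> {0..T}" "\<sigma>\<^sup>2 = 1" "\<tau>\<^sup>2 = 1"
  shows "k = c\<^sup>2 * (Re (dir \<sigma> \<tau> x y))\<^sup>2 + (Im (dir \<sigma> \<tau> x y * cnj (node x y)))\<^sup>2"
proof -
  let ?w = "Complex (U x) (V y)"
  have "of_real c * dir \<sigma> \<tau> x y * sinh (cnj ?w) = Complex (\<sigma> * pu x) (\<tau> * pv y)"
    using nonfocal[OF assms(1,2)] c_pos unfolding dir_def by (simp add: sinh_cnj)
  then show ?thesis
    using momentum_of_direction(1)[OF norm_dir[OF assms], of c ?w] pu_squared[OF assms(1)] assms(3)
    by (simp add: node_def power_mult_distrib)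
qed

end

section \<open>Tangent lines and reflections\<close>

lemma affine_hull_2_points:
  fixes P Q :: point
  shows "affine hull {P, Q} = range (\<lambda>t. P + t *\<^sub>R (Q - P))"
  by (simp add: affine_hull_2_alt)

lemma orthogonal_pair:
  fixes d1 d2 n1 n2 :: real
  assumes "d1 * n1 + d2 * n2 = 0" "(n1, n2) \<noteq> (0, 0)"
  obtains k where "d1 = - k * n2" "d2 = k * n1"
proof -
  define k where "k = (d2 * n1 - d1 * n2) / (n1\<^sup>2 + n2\<^sup>2)"
  have nn: "n1\<^sup>2 + n2\<^sup>2 \<noteq> 0"
    using assms(2) by (simp add: sum_power2_eq_zero_iff)
  have "d1 * (n1\<^sup>2 + n2\<^sup>2) = - (d2 * n1 - d1 * n2) * n2" "d2 * (n1\<^sup>2 + n2\<^sup>2) = (d2 * n1 - d1 * n2) * n1"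
    using assms(1) by algebra+
  then have "d1 = - k * n2" "d2 = k * n1"
    using nn by (simp_all add: k_def field_simps)
  then show ?thesis using that by blast
qed

text \<open>The equation of the dual conic: the line \<open>n1 * z1 + n2 * z2 = 1\<close> is tangent
  iff \<open>(a - m) * n1^2 + (b - m) * n2^2 = 1\<close>. Here \<open>n\<close> is
  \<open>(dy, - dx)\<close> divided by \<open>x * dy - y * dx\<close>, and the denominators are
  cleared. If that divisor is 0, the line passes through the centre and the condition characterizes
  the asymptotes.\<close>

lemma tangent_to_conic_iff:
  fixes a b m x y dx dy :: real
  assumes "m \<noteq> a" "m \<noteq> b" and d: "(dx, dy) \<noteq> (0, 0)"
  shows "tangent_to_conic a b m (affine hull {(x, y), (x + dx, y + dy)}) \<longleftrightarrow>
    (a - m) * dy\<^sup>2 + (b - m) * dx\<^sup>2 = (x * dy - y * dx)\<^sup>2" (is "?L \<longleftrightarrow> ?R")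
proof -
  let ?A = "a - m" and ?B = "b - m"
  have nz: "?A \<noteq> 0" "?B \<noteq> 0" using assms by auto
  have frac: "p / A + q / B = (B * p + A * q) / (A * B)" if "A \<noteq> 0" "B \<noteq> 0" for p q A B :: real
    using that by (simp add: field_simps)
  define L where "L = affine hull {(x, y), (x + dx, y + dy)}"
  have L: "L = range (\<lambda>t. (x + t * dx, y + t * dy))"
    by (simp add: L_def affine_hull_2_points)
  have PL: "(x, y) \<in> L" "(x + dx, y + dy) \<in> L"
    by (simp_all add: L_def hull_inc)
  show ?thesis
  proof
    assume ?L
    then consider T where "T \<in> conic a b m" "L = {Z. (Z - T) \<bullet> conic_normal a b m T = 0}"
      | "asymptote_of_conic a b m L"
      unfolding tangent_to_conic_def L_def by blast
    then show ?R
    proof cases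
      case 1
      obtain T1 T2 where T: "T = (T1, T2)" by (cases T)
      define n1 n2 where "n1 = T1 / ?A" and "n2 = T2 / ?B"
      have Tn: "T1 = ?A * n1" "T2 = ?B * n2" using nz by (simp_all add: n1_def n2_def)
      have 0: "?A * n1\<^sup>2 + ?B * n2\<^sup>2 = 1"
        using 1(1) nz by (simp add: T conic_def n1_def n2_def power_divide power2_eq_square)
      have 1: "L = {Z. (fst Z - T1) * n1 + (snd Z - T2) * n2 = 0}"
        using 1(2) by (simp add: T conic_normal_def n1_def n2_def inner_prod_def)
      have 2: "(x - T1) * n1 + (y - T2) * n2 = 0" "(x + dx - T1) * n1 + (y + dy - T2) * n2 = 0"
        using PL unfolding 1 by auto
      then have "dx * n1 + dy * n2 = 0" by algebra
      moreover have "(n1, n2) \<noteq> (0, 0)" using 0 by auto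
      ultimately obtain k where k: "dx = - k * n2" "dy = k * n1"
        by (rule orthogonal_pair)
      have "x * n1 + y * n2 = 1"
        using 2(1) 0 unfolding Tn by algebra
      then show ?R using 0 unfolding k by algebra
    next
      case 2
      then obtain d1 d2 where d12: "(d1, d2) \<noteq> 0" "d1\<^sup>2 / ?A + d2\<^sup>2 / ?B = 0"
        and L2: "L = range (\<lambda>t. t *\<^sub>R (d1, d2))"
        unfolding asymptote_of_conic_def by (metis prod.collapse)
      obtain t1 t2 where "x = t1 * d1" "y = t1 * d2" "x + dx = t2 * d1" "y + dy = t2 * d2"
        using PL unfolding L2 by auto
      then have t: "x = t1 * d1" "y = t1 * d2" "dx = (t2 - t1) * d1" "dy = (t2 - t1) * d2"
        by (auto simp: algebra_simps)
      have "?B * d1\<^sup>2 + ?A * d2\<^sup>2 = 0" using d12(2) nz by (simp add: frac)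
      moreover have "?A * ((t2 - t1) * d2)\<^sup>2 + ?B * ((t2 - t1) * d1)\<^sup>2 =
          (t2 - t1)\<^sup>2 * (?B * d1\<^sup>2 + ?A * d2\<^sup>2)"
        by (simp add: power2_eq_square algebra_simps)
      ultimately show ?R unfolding t by simp
    qed
  next
    assume R: ?R
    define k where "k = x * dy - y * dx"
    show ?L
    proof (cases "k = 0")
      case False
      define n1 n2 where "n1 = dy / k" and "n2 = - dx / k"
      have d12: "dx = - k * n2" "dy = k * n1" using False by (simp_all add: n1_def n2_def)
      have Pn: "x * n1 + y * n2 = 1"
      proof -
        have "x * n1 + y * n2 = (x * dy - y * dx) / k"
          by (simp add: n1_def n2_def diff_divide_distrib)
        then show ?thesis using False by (simp flip: k_def)
      qed
      have n: "?A * n1\<^sup>2 + ?B * n2\<^sup>2 = 1"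
      proof -
        have "k\<^sup>2 * (?A * n1\<^sup>2 + ?B * n2\<^sup>2) = k\<^sup>2"
          using R unfolding d12 using Pn by algebra
        then show ?thesis using False by simp
      qed
      \<comment> \<open>The point of contact is the pole of the line.\<close>
      let ?T = "(?A * n1, ?B * n2)"
      have "?T \<in> conic a b m"
        using n nz by (simp add: conic_def power2_eq_square mult_ac)
      moreover have "L = {Z. (Z - ?T) \<bullet> conic_normal a b m ?T = 0}"
      proof -
        have "conic_normal a b m ?T = (n1, n2)" using nz by (simp add: conic_normal_def)
        then have "(Z - ?T) \<bullet> conic_normal a b m ?T = fst Z * n1 + snd Z * n2 - 1" for Z
          unfolding n[symmetric] by (simp add: inner_prod_def power2_eq_square algebra_simps)
        then have "{Z. (Z - ?T) \<bullet> conic_normal a b m ?T = 0} = {(z1, z2). z1 * n1 + z2 * n2 = 1}"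
          by auto
        also have "\<dots> = L"
        proof (intro equalityI subsetI)
          fix Z assume Z: "Z \<in> {(z1, z2). z1 * n1 + z2 * n2 = 1}"
          obtain z1 z2 where z: "Z = (z1, z2)" by (cases Z)
          have "(z1 - x) * n1 + (z2 - y) * n2 = 0" using Z Pn by (simp add: z algebra_simps)
          moreover have "(n1, n2) \<noteq> (0, 0)" using n by auto
          ultimately obtain r where r: "z1 - x = - r * n2" "z2 - y = r * n1"
            by (rule orthogonal_pair)
          have "Z = (x + r / k * dx, y + r / k * dy)"
            using r False by (simp add: z d12 field_simps)
          then show "Z \<in> L" unfolding L by blast
        qed (use Pn in \<open>auto simp: L d12 algebra_simps\<close>)
        finally show ?thesis by simp
      qed
      ultimately show ?L unfolding tangent_to_conic_def L_def by blast
    next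
      case True
      have 0: "x * dy = y * dx" using True by (simp add: k_def)
      have "?A * dy\<^sup>2 + ?B * dx\<^sup>2 = 0" using R 0 by simp
      then have "dx\<^sup>2 / ?A + dy\<^sup>2 / ?B = 0" using nz by (simp add: frac add.commute)
      moreover have "L = range (\<lambda>t. t *\<^sub>R (dx, dy))"
      proof -
        have "x * dy + y * (- dx) = 0" "(dy, - dx) \<noteq> (0, 0)" using 0 d by auto
        then obtain s where s: "x = s * dx" "y = s * dy"
          using orthogonal_pair[of x dy y "- dx"] by (metis minus_mult_minus)
        have "range (\<lambda>t. (x + t * dx, y + t * dy)) = range ((\<lambda>t. (t * dx, t * dy)) \<circ> (\<lambda>t. s + t))"
          by (simp add: s o_def algebra_simps)
        also have "\<dots> = (\<lambda>t. (t * dx, t * dy)) ` range (\<lambda>t. s + t)"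
          by (simp only: image_comp)
        finally show ?thesis using surj_plus[of s] by (simp add: L)
      qed
      ultimately have "asymptote_of_conic a b m L"
        unfolding asymptote_of_conic_def using d by (intro exI[of _ "(dx, dy)"]) (auto simp: zero_prod_def)
      then show ?L unfolding tangent_to_conic_def L_def by blast
    qed
  qed
qed

text \<open>The reflection is an involution. This is needed because transposing the table reverses
  the order in which a trajectory visits its vertices.\<close>

lemma reflects_at_sym:
  assumes "reflects_at a b l P Q R"
  shows "reflects_at a b l R Q P"
proof -
  define n d d' where "n = conic_normal a b l Q" and "d = sgn (Q - P)" and "d' = sgn (R - Q)"
  have ne: "P \<noteq> Q" "R \<noteq> Q" and d': "d' = d - (2 * (d \<bullet> n) / (n \<bullet> n)) *\<^sub>R n"
    using assms by (auto simp: reflects_at_def Let_def n_def d_def d'_def)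
  have s: "sgn (Q - R) = - d'" "sgn (P - Q) = - d"
    unfolding d_def d'_def by (simp_all flip: sgn_minus)
  have "(- d') \<bullet> n = d \<bullet> n"
    by (cases "n = 0") (simp_all add: d' inner_diff_left)
  then have "- d = - d' - (2 * ((- d') \<bullet> n) / (n \<bullet> n)) *\<^sub>R n"
    by (simp only:) (simp add: d')
  then show ?thesis
    using ne s by (simp add: reflects_at_def Let_def n_def)
qed

section \<open>Points of the plane as complex numbers\<close>

definition pt :: "complex \<Rightarrow> point" where
  "pt z = (Re z, Im z)"

lemma linear_pt: "linear pt"
  by (rule linearI) (simp_all add: pt_def)

lemma pt_eq_iff [simp]: "pt z = pt w \<longleftrightarrow> z = w"
  by (simp add: pt_def complex_eq_iff)

lemma dist_pt: "dist (pt z) (pt w) = dist z w"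
  by (simp add: pt_def dist_prod_def dist_real_def dist_complex_def cmod_def power2_abs)

lemma continuous_on_pt [continuous_intros]: "continuous_on S f \<Longrightarrow> continuous_on S (\<lambda>x. pt (f x))"
  unfolding pt_def by (intro continuous_intros)

lemma segment_pt: "closed_segment (pt z) (pt w) = pt ` closed_segment z w"
  using closed_segment_linear_image[OF linear_pt] by simp

lemma norm_pt: "norm (pt z) = cmod z"
  by (simp add: pt_def norm_prod_def cmod_def)

lemma sgn_pt:
  assumes "r > 0" "cmod d = 1" "w = z + of_real r * d"
  shows "sgn (pt w - pt z) = pt d"
proof -
  have "pt w - pt z = r *\<^sub>R pt d" by (simp add: assms(3) pt_def)
  then show ?thesis using assms by (simp add: sgn_div_norm norm_pt)
qed

text \<open>In the orthogonal frame of the normal \<open>\<nu>\<close> and its rotation by a right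
  angle the direction has components \<open>A\<close> and \<open>B\<close>, and the reflection in
  the tangent only negates \<open>A\<close>. The normal need not be of unit length.\<close>

lemma reflects_at_pt:
  assumes q: "q = p + of_real r1 * (Complex A B * \<nu>)" and r: "r = q + of_real r2 * (Complex (- A) B * \<nu>)"
    and pos: "r1 > 0" "r2 > 0" and unit: "cmod (Complex A B * \<nu>) = 1"
    and n: "conic_normal a b l (pt q) = g *\<^sub>R pt \<nu>" and g: "g \<noteq> 0"
  shows "reflects_at a b l (pt p) (pt q) (pt r)"
proof -
  have unit': "cmod (Complex (- A) B * \<nu>) = 1"
  proof -
    have "cmod (Complex (- A) B) = cmod (Complex A B)" by (simp add: cmod_def)
    then show ?thesis using unit by (simp only: norm_mult)
  qed
  have "Complex A B * \<nu> \<noteq> 0" "Complex (- A) B * \<nu> \<noteq> 0"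
    using unit unit' by force+
  then have ne: "p \<noteq> q" "r \<noteq> q"
    using pos unfolding q r by auto
  have "\<nu> \<noteq> 0" using unit by force
  define D where "D = (Re \<nu>)\<^sup>2 + (Im \<nu>)\<^sup>2"
  have D: "D \<noteq> 0"
    using \<open>\<nu> \<noteq> 0\<close> by (simp add: D_def complex_eq_iff sum_power2_eq_zero_iff)
  let ?d = "pt (Complex A B * \<nu>)" and ?n = "g *\<^sub>R pt \<nu>"
  have "?d \<bullet> ?n = g * A * D" "?n \<bullet> ?n = g * g * D"
    by (simp_all add: D_def pt_def power2_eq_square algebra_simps)
  then have "2 * (?d \<bullet> ?n) / (?n \<bullet> ?n) = 2 * A / g"
    by (simp only:) (use g D in \<open>simp\<close>)
  then have "?d - (2 * (?d \<bullet> ?n) / (?n \<bullet> ?n)) *\<^sub>R ?n = pt (Complex (- A) B * \<nu>)"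
    using g by (simp only:) (simp add: pt_def)
  then show ?thesis
    using ne unfolding reflects_at_def Let_def n sgn_pt[OF pos(1) unit q] sgn_pt[OF pos(2) unit' r] by simp
qed

text \<open>As \<open>b - m = (a - m) - c^2\<close> and \<open>d\<close> is a unit vector, the
  quadratic form in the tangency condition becomes \<open>a - m\<close> minus a multiple of
  \<open>(Re d)^2\<close>. Tangency to the conic \<open>m\<close> is thus the statement that
  Joachimsthal's integral equals \<open>a - m\<close>.\<close>

lemma tangent_to_conic_direction:
  assumes ab: "a - b = c\<^sup>2" and m: "m \<noteq> a" "m \<noteq> b"
    and q: "q = p + of_real r * d" "r \<noteq> 0" "cmod d = 1"
  shows "tangent_to_conic a b m (affine hull {pt p, pt q}) \<longleftrightarrow>
    a - m = c\<^sup>2 * (Re d)\<^sup>2 + (Im (d * cnj p))\<^sup>2"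
proof -
  have unit: "(Re d)\<^sup>2 + (Im d)\<^sup>2 = 1"
    using q by (simp add: cmod_power2[symmetric])
  have "r * Re d \<noteq> 0 \<or> r * Im d \<noteq> 0" using unit q(2) by auto
  then have "tangent_to_conic a b m (affine hull {(Re p, Im p), (Re p + r * Re d, Im p + r * Im d)}) \<longleftrightarrow>
      (a - m) * (r * Im d)\<^sup>2 + (b - m) * (r * Re d)\<^sup>2 = (Re p * (r * Im d) - Im p * (r * Re d))\<^sup>2"
    by (intro tangent_to_conic_iff m) simp
  also have "\<dots> \<longleftrightarrow> r\<^sup>2 * (a - m) = r\<^sup>2 * (c\<^sup>2 * (Re d)\<^sup>2 + (Im (d * cnj p))\<^sup>2)"
  proof -
    have l: "(a - m) * (r * Im d)\<^sup>2 + (b - m) * (r * Re d)\<^sup>2 = r\<^sup>2 * (a - m) - r\<^sup>2 * (c\<^sup>2 * (Re d)\<^sup>2)"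
      using unit ab by algebra
    have r: "(Re p * (r * Im d) - Im p * (r * Re d))\<^sup>2 = r\<^sup>2 * (Im (d * cnj p))\<^sup>2"
      by (simp add: power2_eq_square algebra_simps)
    show ?thesis unfolding l r distrib_left by (simp only: diff_eq_eq add.commute)
  qed
  finally show ?thesis using q by (simp add: pt_def)
qed

text \<open>\<open>sinh w\<close>, the derivative of \<open>cosh\<close>, and its product with i are
  the directions of the two coordinate curves. The reciprocal of the conjugate differs from them
  only by a positive factor, and it is the form that occurs in \<open>dir\<close>.\<close>

lemma inverse_cnj_sinh:
  assumes "c > 0" "sinh w \<noteq> 0"
  shows "pt (1 / (of_real c * sinh (cnj w))) = (1 / (c * (cmod (sinh w))\<^sup>2)) *\<^sub>R pt (sinh w)"
    and "pt (\<i> * (1 / (of_real c * sinh (cnj w)))) = (1 / (c * (cmod (sinh w))\<^sup>2)) *\<^sub>R pt (\<i> * sinh w)"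
proof -
  have "1 / (of_real c * sinh (cnj w)) = of_real (1 / (c * (cmod (sinh w))\<^sup>2)) * sinh w"
    using assms complex_norm_square[of "sinh w"] by (simp add: sinh_cnj field_simps)
  then show "pt (1 / (of_real c * sinh (cnj w))) = (1 / (c * (cmod (sinh w))\<^sup>2)) *\<^sub>R pt (sinh w)"
    "pt (\<i> * (1 / (of_real c * sinh (cnj w)))) = (1 / (c * (cmod (sinh w))\<^sup>2)) *\<^sub>R pt (\<i> * sinh w)"
    by (simp_all only:) (simp_all add: pt_def Re_divide_of_real Im_divide_of_real)
qed

text \<open>The coordinates are conformal, so the curves on which u is constant have the u-direction
  as normal. \<open>l \<noteq> b\<close> excludes u = 0, where the ellipse collapses to the segment
  between the foci.\<close>

lemma conic_normal_ellipse:
  assumes ab: "a - b = c\<^sup>2" and c: "c > 0"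
    and l: "l = a - c\<^sup>2 * (cosh (Re w))\<^sup>2" "l \<noteq> b" and nz: "sinh w \<noteq> 0"
  obtains g where "g \<noteq> 0" "conic_normal a b l (pt (of_real c * cosh w)) = g *\<^sub>R pt (1 / (of_real c * sinh (cnj w)))"
proof -
  define D where "D = (cmod (sinh w))\<^sup>2"
  have D: "D \<noteq> 0" using nz by (simp add: D_def)
  have al: "a - l = c\<^sup>2 * (cosh (Re w))\<^sup>2" and bl: "b - l = c\<^sup>2 * (sinh (Re w))\<^sup>2"
    using l(1) ab by (auto simp: cosh_square_eq algebra_simps)
  have S: "sinh (Re w) \<noteq> 0" using bl l(2) by auto
  have C: "cosh (Re w) \<noteq> 0" by simp
  have "conic_normal a b l (pt (of_real c * cosh w)) =
      (D / (sinh (Re w) * cosh (Re w))) *\<^sub>R pt (1 / (of_real c * sinh (cnj w)))"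
    unfolding inverse_cnj_sinh[OF c nz] D_def[symmetric] conic_normal_def al bl
    using D S C c by (simp add: pt_def Re_cosh Im_cosh Re_sinh Im_sinh field_simps power2_eq_square)
  then show ?thesis using that D S C by (metis divide_eq_0_iff no_zero_divisors)
qed

lemma conic_normal_hyperbola:
  assumes ab: "a - b = c\<^sup>2" and c: "c > 0"
    and l: "l = a - c\<^sup>2 * (cos (Im w))\<^sup>2" "l \<noteq> a" "l \<noteq> b" and nz: "sinh w \<noteq> 0"
  obtains g where "g \<noteq> 0" "conic_normal a b l (pt (of_real c * cosh w)) = g *\<^sub>R pt (\<i> * (1 / (of_real c * sinh (cnj w))))"
proof -
  define D where "D = (cmod (sinh w))\<^sup>2"
  have D: "D \<noteq> 0" using nz by (simp add: D_def)
  have al: "a - l = c\<^sup>2 * (cos (Im w))\<^sup>2" and bl: "b - l = - (c\<^sup>2 * (sin (Im w))\<^sup>2)"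
    using l(1) ab by (auto simp: cos_squared_eq algebra_simps)
  have S: "sin (Im w) \<noteq> 0" and C: "cos (Im w) \<noteq> 0" using al bl l by auto
  have "conic_normal a b l (pt (of_real c * cosh w)) =
      (- D / (sin (Im w) * cos (Im w))) *\<^sub>R pt (\<i> * (1 / (of_real c * sinh (cnj w))))"
    unfolding inverse_cnj_sinh[OF c nz] D_def[symmetric] conic_normal_def al bl
    using D S C c by (simp add: pt_def Re_cosh Im_cosh Re_sinh Im_sinh field_simps power2_eq_square)
  then show ?thesis using that D S C by (metis divide_eq_0_iff neg_equal_0_iff_equal no_zero_divisors)
qed

section \<open>The family of trajectories\<close>

text \<open>In the parameter square the corners A, B, C, D are \<open>(0, 0)\<close>,
  \<open>(0, T)\<close>, \<open>(T, T)\<close>, \<open>(T, 0)\<close>, so that BD is the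
  antidiagonal. Compared with the domain of \<open>F\<close> the axes are exchanged: AB is the side
  \<open>x = 0\<close>, on which u is constant. \<open>interior\<close> serves to keep the vertices
  of the trajectories away from the corners.\<close>

locale confocal_flow = separated_flow +
  fixes a b m lAB lBC lCD lDA :: real and F :: "point \<Rightarrow> point"
  assumes ab: "a - b = c\<^sup>2" and caustic: "k = a - m" "m \<noteq> a" "m \<noteq> b"
    and conics: "lAB = a - c\<^sup>2 * (cosh (U 0))\<^sup>2" "lBC = a - c\<^sup>2 * (cos (V T))\<^sup>2"
      "lCD = a - c\<^sup>2 * (cosh (U T))\<^sup>2" "lDA = a - c\<^sup>2 * (cos (V 0))\<^sup>2"
    and nondegenerate: "lAB \<noteq> b" "lBC \<noteq> a" "lBC \<noteq> b" "lCD \<noteq> b" "lDA \<noteq> a" "lDA \<noteq> b"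
    and in_table: "\<And>x y. x \<in> {0..T} \<Longrightarrow> y \<in> {0..T} \<Longrightarrow> pt (node x y) \<in> table F"
    and in_sides: "\<And>y. y \<in> {0..T} \<Longrightarrow> pt (node 0 y) \<in> side_AB F"
      "\<And>x. x \<in> {0..T} \<Longrightarrow> pt (node x T) \<in> side_BC F"
      "\<And>y. y \<in> {0..T} \<Longrightarrow> pt (node T y) \<in> side_CD F"
      "\<And>x. x \<in> {0..T} \<Longrightarrow> pt (node x 0) \<in> side_DA F"
    and corners: "corners F = {pt (node 0 0), pt (node 0 T), pt (node T T), pt (node T 0)}"
    and node_inj: "\<And>x y x' y'. {x, y, x', y'} \<subseteq> {0..T} \<Longrightarrow> node x y = node x' y' \<Longrightarrow> U x = U x' \<and> V y = V y'"
    and interior: "\<And>x. 0 < x \<Longrightarrow> x < T \<Longrightarrow> U x \<notin> {U 0, U T} \<and> V x \<notin> {V 0, V T}"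
begin

lemma not_corner:
  assumes "0 < x" "x < T" "y \<in> {0..T}"
  shows "pt (node x y) \<notin> corners F" "pt (node y x) \<notin> corners F"
proof -
  have "node x y \<noteq> node x' y'" "node y x \<noteq> node y' x'" if "x' \<in> {0, T}" "y' \<in> {0, T}" for x' y'
    using interior[OF assms(1,2)] node_inj[of x y x' y'] node_inj[of y x y' x'] assms T_pos that by auto
  then show "pt (node x y) \<notin> corners F" "pt (node y x) \<notin> corners F"
    by (simp_all add: corners)
qed

text \<open>The incoming direction is constant along its ray, so it may be evaluated at the point of
  impact. There both directions are written in the same frame, whose first axis is normal to the
  side, and they differ in the sign of \<open>pu\<close>.\<close>

lemma reflects_u:
  assumes 1: "ray \<sigma> \<tau> d1 x0 y0 x y" "d1 > 0" and 2: "ray (- \<sigma>) \<tau> d2 x y x1 y1" "d2 > 0"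
    and l: "l = a - c\<^sup>2 * (cosh (U x))\<^sup>2" "l \<noteq> b"
  shows "reflects_at a b l (pt (node x0 y0)) (pt (node x y)) (pt (node x1 y1))"
proof -
  let ?w = "Complex (U x) (V y)"
  define \<nu> where "\<nu> = 1 / (of_real c * sinh (cnj ?w))"
  note xy = square(3,4)[OF 1(1)]
  have e: "dir \<sigma> \<tau> x y = Complex (\<sigma> * pu x) (\<tau> * pv y) * \<nu>"
    "dir (- \<sigma>) \<tau> x y = Complex (- (\<sigma> * pu x)) (\<tau> * pv y) * \<nu>"
    by (simp_all add: dir_def \<nu>_def)
  obtain g where g: "g \<noteq> 0" "conic_normal a b l (pt (node x y)) = g *\<^sub>R pt \<nu>"
    using conic_normal_ellipse[OF ab c_pos, of l ?w] l nonfocal[OF xy] unfolding node_def \<nu>_def by auto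
  show ?thesis
  proof (rule reflects_at_pt[OF _ _ travel_pos[OF 1] travel_pos[OF 2] _ g(2,1)])
    show "node x y = node x0 y0 + of_real (travel \<sigma> \<tau> x0 y0 x y) * (Complex (\<sigma> * pu x) (\<tau> * pv y) * \<nu>)"
      using node_end[OF 1(1)] unfolding e(1)[symmetric] dir_end[OF 1(1)] .
    show "node x1 y1 = node x y + of_real (travel (- \<sigma>) \<tau> x y x1 y1) * (Complex (- (\<sigma> * pu x)) (\<tau> * pv y) * \<nu>)"
      using node_end[OF 2(1)] unfolding e(2) .
    show "cmod (Complex (\<sigma> * pu x) (\<tau> * pv y) * \<nu>) = 1"
      using norm_dir[OF xy signs_squared[OF 1(1)]] unfolding e(1) .
  qed
qed

lemma reflects_v:
  assumes 1: "ray \<sigma> \<tau> d1 x0 y0 x y" "d1 > 0" and 2: "ray \<sigma> (- \<tau>) d2 x y x1 y1" "d2 > 0"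
    and l: "l = a - c\<^sup>2 * (cos (V y))\<^sup>2" "l \<noteq> a" "l \<noteq> b"
  shows "reflects_at a b l (pt (node x0 y0)) (pt (node x y)) (pt (node x1 y1))"
proof -
  let ?w = "Complex (U x) (V y)"
  define \<nu> where "\<nu> = \<i> * (1 / (of_real c * sinh (cnj ?w)))"
  note xy = square(3,4)[OF 1(1)]
  \<comment> \<open>Rotating the frame by i makes the v-component, up to sign the second one so far,
    the normal component.\<close>
  have "Complex A B * z = Complex B (- A) * (\<i> * z)" for A B z
    by (simp add: complex_eq_iff)
  then have e: "dir \<sigma> \<tau> x y = Complex (\<tau> * pv y) (- (\<sigma> * pu x)) * \<nu>"
    "dir \<sigma> (- \<tau>) x y = Complex (- (\<tau> * pv y)) (- (\<sigma> * pu x)) * \<nu>"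
    unfolding dir_def \<nu>_def by (simp_all add: divide_inverse)
  obtain g where g: "g \<noteq> 0" "conic_normal a b l (pt (node x y)) = g *\<^sub>R pt \<nu>"
    using conic_normal_hyperbola[OF ab c_pos, of l ?w] l nonfocal[OF xy] unfolding node_def \<nu>_def by auto
  show ?thesis
  proof (rule reflects_at_pt[OF _ _ travel_pos[OF 1] travel_pos[OF 2] _ g(2,1)])
    show "node x y = node x0 y0 + of_real (travel \<sigma> \<tau> x0 y0 x y) * (Complex (\<tau> * pv y) (- (\<sigma> * pu x)) * \<nu>)"
      using node_end[OF 1(1)] unfolding e(1)[symmetric] dir_end[OF 1(1)] .
    show "node x1 y1 = node x y + of_real (travel \<sigma> (- \<tau>) x y x1 y1) * (Complex (- (\<tau> * pv y)) (- (\<sigma> * pu x)) * \<nu>)"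
      using node_end[OF 2(1)] unfolding e(2) .
    show "cmod (Complex (\<tau> * pv y) (- (\<sigma> * pu x)) * \<nu>) = 1"
      using norm_dir[OF xy signs_squared[OF 1(1)]] unfolding e(1) .
  qed
qed

lemma ray_tangent:
  assumes r: "ray \<sigma> \<tau> d x0 y0 x1 y1" "d > 0"
  shows "tangent_to_conic a b m (affine hull {pt (node x0 y0), pt (node x1 y1)})"
  using tangent_to_conic_direction[OF ab caustic(2,3) node_end[OF r(1)]] travel_pos[OF r]
    norm_dir[OF square(1,2) signs_squared, OF r(1) r(1) r(1) r(1)]
    direction_caustic[OF square(1,2) signs_squared, OF r(1) r(1) r(1) r(1)] caustic(1) by simp

lemma ray_in_table:
  assumes "ray \<sigma> \<tau> d x0 y0 x1 y1"
  shows "closed_segment (pt (node x0 y0)) (pt (node x1 y1)) \<subseteq> table F"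
  using segment_subset[OF assms] in_table unfolding segment_pt by fastforce

text \<open>Vertices of the inscribed rectangle with sides of slope 1 and -1. It collapses to the
  antidiagonal BD at \<open>t = 0\<close> and to the diagonal AC at \<open>t = 1\<close>.\<close>

definition P :: "real \<Rightarrow> point" where "P t = pt (node 0 (T * (1 - t)))"
definition Q :: "real \<Rightarrow> point" where "Q t = pt (node (T * t) T)"
definition R :: "real \<Rightarrow> point" where "R t = pt (node T (T * t))"
definition S :: "real \<Rightarrow> point" where "S t = pt (node (T * (1 - t)) 0)"

text \<open>The end values of \<open>t\<close> are included: two of the four durations are 0 there,
  and the perimeter formula then covers the diagonals as well.\<close>

lemma rays:
  assumes "t \<in> {0..1}"
  shows "ray (- 1) 1 (T * (1 - t)) (T * (1 - t)) 0 0 (T * (1 - t))"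
    and "ray 1 1 (T * t) 0 (T * (1 - t)) (T * t) T"
    and "ray 1 (- 1) (T * (1 - t)) (T * t) T T (T * t)"
    and "ray (- 1) (- 1) (T * t) T (T * t) (T * (1 - t)) 0"
  using assms T_pos mult_left_mono[of t 1 T] by (auto simp: ray_def algebra_simps)

lemma trajectory:
  assumes t: "0 < t" "t < 1"
  shows "billiard_trajectory a b lAB lBC lCD lDA F (P t) (Q t) (R t) (S t)"
    and "rays_tangent a b m (P t) (Q t) (R t) (S t)"
proof -
  have t': "t \<in> {0..1}" using t by simp
  have pos: "0 < T * t" "T * t < T" "0 < T * (1 - t)" "T * (1 - t) < T"
    using t T_pos by simp_all
  note r = rays[OF t']
  \<comment> \<open>The sign 1 is written as \<open>- (- 1)\<close> to match the negated sign after
    a reflection.\<close>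
  have r1: "ray (- 1) (- (- 1)) (T * (1 - t)) (T * (1 - t)) 0 0 (T * (1 - t))"
    and r2: "ray (- (- 1)) 1 (T * t) 0 (T * (1 - t)) (T * t) T"
    using r(1,2) by simp_all
  show "billiard_trajectory a b lAB lBC lCD lDA F (P t) (Q t) (R t) (S t)"
    unfolding billiard_trajectory_def P_def Q_def R_def S_def
  proof (intro conjI DiffI)
    show "reflects_at a b lAB (pt (node (T * (1 - t)) 0)) (pt (node 0 (T * (1 - t)))) (pt (node (T * t) T))"
      by (rule reflects_u[OF r(1) _ r2 _ conics(1)]) (use pos nondegenerate in auto)
    show "reflects_at a b lBC (pt (node 0 (T * (1 - t)))) (pt (node (T * t) T)) (pt (node T (T * t)))"
      by (rule reflects_v[OF r(2) _ r(3) _ conics(2)]) (use pos nondegenerate in auto)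
    show "reflects_at a b lCD (pt (node (T * t) T)) (pt (node T (T * t))) (pt (node (T * (1 - t)) 0))"
      by (rule reflects_u[OF r(3) _ r(4) _ conics(3)]) (use pos nondegenerate in auto)
    show "reflects_at a b lDA (pt (node T (T * t))) (pt (node (T * (1 - t)) 0)) (pt (node 0 (T * (1 - t))))"
      by (rule reflects_v[OF r(4) _ r1 _ conics(4)]) (use pos nondegenerate in auto)
  qed (use pos T_pos in_sides not_corner ray_in_table[OF r(1)] ray_in_table[OF r(2)]
      ray_in_table[OF r(3)] ray_in_table[OF r(4)] in auto)
  show "rays_tangent a b m (P t) (Q t) (R t) (S t)"
    unfolding rays_tangent_def P_def Q_def R_def S_def
    using pos by (intro conjI ray_tangent[OF r(1)] ray_tangent[OF r(2)] ray_tangent[OF r(3)] ray_tangent[OF r(4)])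
qed

text \<open>A circuit runs through \<open>[0, T]\<close> twice in each coordinate, so the values of
  \<open>K\<close> and \<open>N\<close> at the intermediate vertices telescope.\<close>

lemma perimeter_trajectory:
  assumes "t \<in> {0..1}"
  shows "perimeter (P t) (Q t) (R t) (S t) = 2 * (K T - K 0) + 2 * (N T - N 0)"
proof -
  note r = rays[OF assms]
  show ?thesis
    unfolding perimeter_def P_def Q_def R_def S_def dist_pt
      dist_node[OF r(1)] dist_node[OF r(2)] dist_node[OF r(3)] dist_node[OF r(4)]
    by (simp add: travel_def)
qed

lemma continuous_trajectory:
  "continuous_on {0..1} P" "continuous_on {0..1} Q" "continuous_on {0..1} R" "continuous_on {0..1} S"
proof -
  have *: "continuous_on {0..1} (\<lambda>t. f (T * t))" "continuous_on {0..1} (\<lambda>t. f (T * (1 - t)))"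
    if "continuous_on {0..T} f" for f :: "real \<Rightarrow> real"
    by (rule continuous_on_compose2[OF that];
        use T_pos in \<open>auto intro!: continuous_intros simp: mult_left_le algebra_simps\<close>)+
  show "continuous_on {0..1} P" "continuous_on {0..1} Q" "continuous_on {0..1} R" "continuous_on {0..1} S"
    unfolding P_def[abs_def] Q_def[abs_def] R_def[abs_def] S_def[abs_def] node_def Complex_eq
    by (intro continuous_intros * continuous)+
qed

lemma ends_trajectory:
  "P 0 = pt (node 0 T)" "Q 0 = pt (node 0 T)" "R 0 = pt (node T 0)" "S 0 = pt (node T 0)"
  "P 1 = pt (node 0 0)" "Q 1 = pt (node T T)" "R 1 = pt (node T T)" "S 1 = pt (node 0 0)"
  by (simp_all add: P_def Q_def R_def S_def)

lemma diagonal_tangent: "tangent_to_conic a b m (affine hull {pt (node 0 0), pt (node T T)})"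
  by (rule ray_tangent[of 1 1 T]) (use T_pos in \<open>auto simp: ray_def\<close>)

text \<open>The common perimeter is twice the length of BD at \<open>t = 0\<close> and twice the
  length of AC at \<open>t = 1\<close>.\<close>

lemma diagonals_equal: "dist (pt (node 0 0)) (pt (node T T)) = dist (pt (node 0 T)) (pt (node T 0))"
  using perimeter_trajectory[of 0] perimeter_trajectory[of 1]
  by (simp add: perimeter_def ends_trajectory dist_commute)

end

section \<open>Lifting the table to elliptic coordinates\<close>

text \<open>Solving \<open>z = cosh w\<close> gives \<open>exp w = z + sqrt (z^2 - 1)\<close>. The
  root has a continuous branch since \<open>z\<close> avoids 1 and -1, and the logarithm has one
  since the sum with the root and the difference have product 1, so neither is 0.\<close>

lemma continuous_cosh_lift:
  fixes f :: "'a::real_normed_vector \<Rightarrow> complex"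
  assumes f: "continuous_on S f" and S: "contractible S"
    and foci: "\<And>x. x \<in> S \<Longrightarrow> f x \<noteq> 1 \<and> f x \<noteq> -1"
  obtains G where "continuous_on S G" "\<And>x. x \<in> S \<Longrightarrow> f x = cosh (G x)"
proof -
  have nz: "(f x)\<^sup>2 - 1 \<noteq> 0" if "x \<in> S" for x
    using foci[OF that] by (simp add: power2_eq_1_iff)
  have "continuous_on S (\<lambda>x. (f x)\<^sup>2 - 1)"
    by (intro continuous_intros f)
  from continuous_sqrt_on_contractible[OF this S nz]
  obtain g where g: "continuous_on S g" "\<And>x. x \<in> S \<Longrightarrow> (f x)\<^sup>2 - 1 = (g x)\<^sup>2"
    by blast
  have fg: "(f x + g x) * (f x - g x) = 1" if "x \<in> S" for x
    using g(2)[OF that] by algebra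
  then have "f x + g x \<noteq> 0" if "x \<in> S" for x
    using that by force
  then obtain G where G: "continuous_on S G" "\<And>x. x \<in> S \<Longrightarrow> f x + g x = exp (G x)"
    using continuous_logarithm_on_contractible[OF continuous_on_add[OF f g(1)] S] by metis
  have "f x = cosh (G x)" if "x \<in> S" for x
  proof -
    have "exp (- G x) = f x - g x"
      using fg[OF that] unfolding G(2)[OF that] exp_minus by (simp add: inverse_unique)
    then show ?thesis
      using G(2)[OF that] by (simp add: cosh_field_def flip: G(2)[OF that])
  qed
  then show ?thesis using that G(1) by blast
qed

text \<open>The values of \<open>g\<close> form an interval without critical points of
  \<open>f\<close>, whereas two different values with equal image under \<open>f\<close> would have
  one between them. Applied to the sides, it turns a constant \<open>cosh^2 u\<close> into a
  constant u, and likewise for v.\<close>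

lemma connected_level_set_constant:
  fixes g :: "'a::topological_space \<Rightarrow> real" and f f' :: "real \<Rightarrow> real"
  assumes "connected S" "continuous_on S g" "\<And>x. x \<in> S \<Longrightarrow> f (g x) = k"
    and f: "\<And>v. (f has_real_derivative f' v) (at v)" and nz: "\<And>x. x \<in> S \<Longrightarrow> f' (g x) \<noteq> 0"
    and "x \<in> S" "y \<in> S"
  shows "g x = g y"
proof -
  have *: False if xy: "x \<in> S" "y \<in> S" and less: "g x < g y" for x y
  proof -
    obtain z where z: "g x < z" "z < g y" "f (g y) - f (g x) = (g y - g x) * f' z"
      using MVT2[OF less f] by blast
    then have "f' z = 0" using assms(3) xy less by simp
    moreover have "z \<in> g ` S"
      using connectedD_interval[OF connected_continuous_image[OF assms(2,1)], of "g x" "g y" z] xy z by auto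
    ultimately show False using nz by auto
  qed
  show ?thesis using * assms(6,7) by (metis linorder_neqE_linordered_idom)
qed

text \<open>Unordered segments are used because the lift does not determine which of two opposite
  sides has the larger coordinate.\<close>

definition rectangle :: "real \<Rightarrow> real \<Rightarrow> real \<Rightarrow> real \<Rightarrow> complex set" where
  "rectangle u0 u1 v0 v1 = {w. Re w \<in> closed_segment u0 u1 \<and> Im w \<in> closed_segment v0 v1}"

lemma rectangle_eq_cbox:
  "rectangle u0 u1 v0 v1 = cbox (Complex (min u0 u1) (min v0 v1)) (Complex (max u0 u1) (max v0 v1))"
  by (auto simp: rectangle_def in_cbox_complex_iff closed_segment_eq_real_ivl min_def max_def)

text \<open>The sides fill the boundary of the rectangle. The image of the open square is connected
  and, by invariance of domain, open; it avoids that boundary, so it lies inside or outside, and it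
  fills the region in which it lies. The outside is unbounded and the image is not.\<close>

lemma injective_image_of_square:
  fixes G :: "point \<Rightarrow> complex"
  assumes cont: "continuous_on unit_square G" and inj: "inj_on G unit_square"
    and AB: "\<And>s. s \<in> {0..1} \<Longrightarrow> Re (G (s, 0)) = u0" and BC: "\<And>s. s \<in> {0..1} \<Longrightarrow> Im (G (1, s)) = v1"
    and CD: "\<And>s. s \<in> {0..1} \<Longrightarrow> Re (G (s, 1)) = u1" and DA: "\<And>s. s \<in> {0..1} \<Longrightarrow> Im (G (0, s)) = v0"
  shows "G ` unit_square = rectangle u0 u1 v0 v1"
    and "G ` ({0..1} \<times> {0}) = {w. Re w = u0 \<and> Im w \<in> closed_segment v0 v1}"
    and "G ` ({1} \<times> {0..1}) = {w. Re w \<in> closed_segment u0 u1 \<and> Im w = v1}"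
    and "G ` ({0..1} \<times> {1}) = {w. Re w = u1 \<and> Im w \<in> closed_segment v0 v1}"
    and "G ` ({0} \<times> {0..1}) = {w. Re w \<in> closed_segment u0 u1 \<and> Im w = v0}"
proof -
  have sub: "continuous_on {0..1} (\<lambda>s. G (s, r))" "continuous_on {0..1} (\<lambda>s. G (r, s))"
    if "r \<in> {0..1}" for r
    by (rule continuous_on_compose2[OF cont]; use that in \<open>auto intro!: continuous_intros simp: unit_square_def\<close>)+
  have eqD: "p = q" if "G p = G q" "p \<in> unit_square" "q \<in> unit_square" for p q
    using inj that by (auto dest: inj_onD)
  have seg: "f ` {0..1} = closed_segment (f 0) (f 1)" if "continuous_on {0..1} f" "inj_on f {0..1}" for f :: "real \<Rightarrow> real"
    using continuous_injective_image_segment_1[of 0 1 f] that by (simp add: closed_segment_eq_real_ivl)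
  have line: "x = y" if "G (x, r) = G (y, r) \<or> G (r, x) = G (r, y)" "{x, y, r} \<subseteq> {0..1}" for x y r
    using eqD[of "(x, r)" "(y, r)"] eqD[of "(r, x)" "(r, y)"] that by (auto simp: unit_square_def)
  \<comment> \<open>On each side one coordinate is constant, so injectivity passes to the other
    coordinate alone.\<close>
  have "inj_on (\<lambda>s. Im (G (s, 0))) {0..1}" "inj_on (\<lambda>s. Im (G (s, 1))) {0..1}"
    by (rule inj_onI, rule line[of _ 0], auto simp: complex_eq_iff AB)
      (rule inj_onI, rule line[of _ 1], auto simp: complex_eq_iff CD)
  moreover have "inj_on (\<lambda>s. Re (G (1, s))) {0..1}" "inj_on (\<lambda>s. Re (G (0, s))) {0..1}"
    by (rule inj_onI, rule line[of _ 1], auto simp: complex_eq_iff BC)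
      (rule inj_onI, rule line[of _ 0], auto simp: complex_eq_iff DA)
  ultimately have im: "(\<lambda>s. Im (G (s, 0))) ` {0..1} = closed_segment v0 v1"
    "(\<lambda>s. Im (G (s, 1))) ` {0..1} = closed_segment v0 v1"
    "(\<lambda>s. Re (G (1, s))) ` {0..1} = closed_segment u0 u1"
    "(\<lambda>s. Re (G (0, s))) ` {0..1} = closed_segment u0 u1"
    using AB[of 0] AB[of 1] BC[of 0] BC[of 1] CD[of 0] CD[of 1] DA[of 0] DA[of 1]
    by (subst seg; auto intro!: continuous_intros sub)+
  show sides: "G ` ({0..1} \<times> {0}) = {w. Re w = u0 \<and> Im w \<in> closed_segment v0 v1}"
    "G ` ({1} \<times> {0..1}) = {w. Re w \<in> closed_segment u0 u1 \<and> Im w = v1}"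
    "G ` ({0..1} \<times> {1}) = {w. Re w = u1 \<and> Im w \<in> closed_segment v0 v1}"
    "G ` ({0} \<times> {0..1}) = {w. Re w \<in> closed_segment u0 u1 \<and> Im w = v0}"
    using AB BC CD DA im
    by (auto simp: image_iff complex_eq_iff set_eq_iff)
  define p q where "p = Complex (min u0 u1) (min v0 v1)" and "q = Complex (max u0 u1) (max v0 v1)"
  define E where "E = ({0..1} \<times> {0}) \<union> ({1} \<times> {0..1}) \<union> ({0..1} \<times> {1}) \<union> ({0::real} \<times> {0..1::real})"
  define I where "I = {0<..<1::real} \<times> {0<..<1::real}"
  define Out where "Out = G ` I"
  have IE: "unit_square = I \<union> E" "I \<inter> E = {}" by (auto simp: unit_square_def I_def E_def)
  have GE: "G ` E = cbox p q - box p q"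
  proof -
    have img: "G ` E = {w. Re w \<in> closed_segment u0 u1 \<and> Im w \<in> closed_segment v0 v1 \<and>
        ((Re w = u0 \<or> Re w = u1) \<or> (Im w = v0 \<or> Im w = v1))}"
      unfolding E_def image_Un sides by auto
    have seg: "x \<in> closed_segment r s \<longleftrightarrow> min r s \<le> x \<and> x \<le> max r s" for x r s :: real
      by (auto simp: closed_segment_eq_real_ivl)
    have ends: "x = r \<or> x = s \<longleftrightarrow> \<not> (min r s < x \<and> x < max r s)" if "x \<in> closed_segment r s" for x r s :: real
      using that by (auto simp: closed_segment_eq_real_ivl min_def max_def split: if_splits)
    have "w \<in> cbox p q - box p q \<longleftrightarrow> Re w \<in> closed_segment u0 u1 \<and> Im w \<in> closed_segment v0 v1 \<and>
        ((Re w = u0 \<or> Re w = u1) \<or> (Im w = v0 \<or> Im w = v1))" for w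
      using ends[of "Re w" u0 u1] ends[of "Im w" v0 v1]
      unfolding p_def q_def Diff_iff in_cbox_complex_iff in_box_complex_iff complex.sel seg
        atLeastAtMost_iff greaterThanLessThan_iff by blast
    then show ?thesis
      unfolding img by (intro set_eqI) (simp only: mem_Collect_eq)
  qed
  have disj: "Out \<inter> G ` E = {}"
    using inj_on_image_Int[OF inj, of I E] IE by (auto simp: Out_def)
  have open_Out: "open Out"
    unfolding Out_def
  proof (rule invariance_of_domain_gen)
    show "continuous_on I G" "inj_on G I"
      using cont inj IE by (auto intro: continuous_on_subset inj_on_subset)
  qed (auto simp: I_def intro: open_Times)
  have "connected I" unfolding I_def by (intro connected_Times) auto
  then have conn: "connected Out"
    unfolding Out_def by (rule connected_continuous_image[rotated]) (use cont IE in \<open>auto intro: continuous_on_subset\<close>)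
  have comp: "compact (G ` unit_square)"
    unfolding unit_square_def
    by (rule compact_continuous_image) (use cont in \<open>auto simp: unit_square_def intro: compact_Times\<close>)
  have ne: "Out \<noteq> {}" by (auto simp: Out_def I_def)
  have sq: "G ` unit_square = Out \<union> (cbox p q - box p q)"
    unfolding IE(1) image_Un GE Out_def ..
  \<comment> \<open>In a region \<open>R\<close> off the boundary the compact image of the square
    coincides with \<open>Out\<close>, which makes \<open>Out\<close> both closed and open in
    \<open>R\<close>.\<close>
  have clopen: "Out = R" if R: "open R" "connected R" "R \<inter> (cbox p q - box p q) = {}" "Out \<subseteq> R" for R
  proof -
    have "Out = R \<inter> G ` unit_square" using R sq by blast
    then have "closedin (top_of_set R) Out"
      using compact_imp_closed[OF comp] by (metis closedin_closed_Int)
    moreover have "openin (top_of_set R) Out"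
      using open_Out R by (simp add: openin_open_eq)
    ultimately show ?thesis using R(2) ne unfolding connected_clopen by blast
  qed
  have "Out \<subseteq> box p q \<union> - cbox p q" using disj GE by blast
  then consider "Out \<subseteq> box p q" | "Out \<subseteq> - cbox p q"
    using connectedD[OF conn, of "box p q" "- cbox p q"] box_subset_cbox[of p q] by blast
  then have "Out = box p q"
  proof cases
    case 1
    then show ?thesis by (intro clopen) (auto intro: convex_connected)
  next
    case 2
    have "connected (- cbox p q)"
      by (rule connected_complement_bounded_convex) auto
    then have "Out = - cbox p q"
      using 2 by (intro clopen) auto
    moreover have "bounded Out"
      using compact_imp_bounded[OF comp] sq by (metis bounded_Un)
    ultimately have "bounded (UNIV :: complex set)"
      by (metis Compl_partition bounded_Un bounded_cbox)
    then show ?thesis using not_bounded_UNIV by blast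
  qed
  then show "G ` unit_square = rectangle u0 u1 v0 v1"
    unfolding sq rectangle_eq_cbox p_def[symmetric] q_def[symmetric]
    using box_subset_cbox[of p q] by blast
qed

section \<open>The given diagonal in separated coordinates\<close>

lemma has_vector_derivative_complex_quotient:
  fixes f :: "real \<Rightarrow> complex"
  shows "(f has_vector_derivative d) (at s) \<longleftrightarrow>
    ((\<lambda>t. (f t - f s) / of_real (t - s)) \<longlongrightarrow> d) (at s)"
  by (simp add: has_vector_derivative_complex_iff has_field_derivative_iff tendsto_complex_iff
      del: of_real_diff)

text \<open>The chain rule backwards: \<open>W\<close> is only known to be continuous.
  Caratheodory's factorization of \<open>cosh\<close> at \<open>W s\<close> allows the difference
  quotient to be divided by a factor that tends to \<open>sinh (W s)\<close>.\<close>

lemma cosh_lift_deriv: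
  fixes W :: "real \<Rightarrow> complex"
  assumes W: "isCont W s" and sinh: "sinh (W s) \<noteq> 0"
    and d: "((\<lambda>s. cosh (W s)) has_vector_derivative d) (at s)"
  shows "(W has_vector_derivative d / sinh (W s)) (at s)"
proof -
  obtain g where g: "\<And>z. cosh z - cosh (W s) = g z * (z - W s)" "isCont g (W s)" "g (W s) = sinh (W s)"
    using CARAT_DERIV[of "cosh :: complex \<Rightarrow> complex" "sinh (W s)" "W s"] has_field_derivative_cosh[OF DERIV_ident, of "W s"] by auto
  have gW: "((\<lambda>t. g (W t)) \<longlongrightarrow> sinh (W s)) (at s)"
    using isCont_o2[OF W g(2)] g(3) by (simp add: isCont_def)
  have "((\<lambda>t. ((cosh (W t) - cosh (W s)) / of_real (t - s)) / g (W t)) \<longlongrightarrow> d / sinh (W s)) (at s)"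
    using d gW sinh unfolding has_vector_derivative_complex_quotient by (intro tendsto_divide) auto
  moreover have "eventually (\<lambda>t. ((cosh (W t) - cosh (W s)) / of_real (t - s)) / g (W t) = (W t - W s) / of_real (t - s)) (at s)"
    using tendsto_imp_eventually_ne[OF gW sinh] by eventually_elim (simp add: g(1))
  ultimately show ?thesis
    unfolding has_vector_derivative_complex_quotient by (blast intro: Lim_transform_eventually)
qed

text \<open>\<open>\<theta>\<close> is the time as a function of the arc length. Its inverse
  \<open>\<rho>\<close> solves \<open>\<rho>' = h \<rho>\<close> and serves to change from arc
  length to time.\<close>

lemma real_inverse_flow:
  fixes \<theta> h :: "real \<Rightarrow> real"
  assumes L: "L > 0" and cont: "continuous_on {0..L} \<theta>" and 0: "\<theta> 0 = 0"
    and deriv: "\<And>s. 0 < s \<Longrightarrow> s < L \<Longrightarrow> (\<theta> has_real_derivative 1 / h s) (at s)"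
    and pos: "\<And>s. 0 < s \<Longrightarrow> s < L \<Longrightarrow> h s > 0"
  obtains \<rho> where "\<theta> L > 0" "continuous_on {0..\<theta> L} \<rho>" "\<rho> 0 = 0" "\<rho> (\<theta> L) = L"
    "\<And>t. t \<in> {0..\<theta> L} \<Longrightarrow> \<rho> t \<in> {0..L}"
    "\<And>t. 0 < t \<Longrightarrow> t < \<theta> L \<Longrightarrow> 0 < \<rho> t \<and> \<rho> t < L"
    "\<And>t. 0 < t \<Longrightarrow> t < \<theta> L \<Longrightarrow> (\<rho> has_real_derivative h (\<rho> t)) (at t)"
proof -
  let ?T = "\<theta> L"
  have mono: "\<theta> r < \<theta> s" if "r < s" "0 \<le> r" "s \<le> L" for r s
  proof (rule DERIV_pos_imp_increasing_open[OF that(1)])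
    show "\<exists>y. (\<theta> has_real_derivative y) (at x) \<and> 0 < y" if "r < x" "x < s" for x
      using deriv[of x] pos[of x] that \<open>0 \<le> r\<close> \<open>s \<le> L\<close> by (intro exI[of _ "1 / h x"]) auto
    show "continuous_on {r..s} \<theta>"
      using continuous_on_subset[OF cont] that by auto
  qed
  have T: "?T > 0" using mono[of 0 L] L 0 by simp
  have inj: "inj_on \<theta> {0..L}"
    by (rule inj_onI) (metis atLeastAtMost_iff linorder_neqE_linordered_idom mono order_less_irrefl)
  have img: "\<theta> ` {0..L} = {0..?T}"
    using continuous_injective_image_segment_1[of 0 L \<theta>] cont inj L 0 T
    by (simp add: closed_segment_eq_real_ivl)
  define \<rho> where "\<rho> = the_inv_into {0..L} \<theta>"
  have contR: "continuous_on {0..?T} \<rho>"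
    using continuous_on_inv_into[OF cont compact_Icc inj] by (simp add: img \<rho>_def)
  have R\<theta>: "\<rho> (\<theta> s) = s" if "s \<in> {0..L}" for s
    using the_inv_into_f_f[OF inj that] by (simp add: \<rho>_def)
  have \<theta>R: "\<theta> (\<rho> t) = t" and Rin: "\<rho> t \<in> {0..L}" if "t \<in> {0..?T}" for t
    using that f_the_inv_into_f[OF inj, of t] the_inv_into_into[OF inj, of t "{0..L}"]
    by (auto simp: img \<rho>_def)
  have R0: "\<rho> 0 = 0" and RT: "\<rho> ?T = L"
    using R\<theta>[of 0] R\<theta>[of L] L 0 by auto
  have Rop: "0 < \<rho> t \<and> \<rho> t < L" if "0 < t" "t < ?T" for t
    using that \<theta>R[of t] Rin[of t] 0 by (metis atLeastAtMost_iff order_less_le less_imp_le)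
  have "(\<rho> has_real_derivative h (\<rho> t)) (at t)" if t: "0 < t" "t < ?T" for t
  proof -
    have "isCont \<rho> t"
      by (rule continuous_on_interior[OF contR]) (use t in auto)
    then have "(\<rho> has_real_derivative inverse (1 / h (\<rho> t))) (at t)"
      using Rop[OF t] pos[of "\<rho> t"] \<theta>R t
      by (intro DERIV_inverse_function[where f = \<theta> and a = 0 and b = ?T] deriv) auto
    then show ?thesis by simp
  qed
  then show ?thesis using that T contR R0 RT Rin Rop by blast
qed

text \<open>An interior point with an end value would be an extremum, hence critical, and Rolle's
  theorem between it and that end would give a second critical point.\<close>

lemma unique_critical_point_interior:
  fixes f f' :: "real \<Rightarrow> real"
  assumes cont: "continuous_on {0..L} f"
    and deriv: "\<And>s. 0 < s \<Longrightarrow> s < L \<Longrightarrow> (f has_real_derivative f' s) (at s)"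
    and between: "\<And>s. s \<in> {0..L} \<Longrightarrow> f s \<in> closed_segment (f 0) (f L)"
    and unique: "\<And>r s. 0 < r \<Longrightarrow> r < L \<Longrightarrow> 0 < s \<Longrightarrow> s < L \<Longrightarrow> f' r = 0 \<Longrightarrow> f' s = 0 \<Longrightarrow> r = s"
    and s: "0 < s" "s < L"
  shows "f s \<notin> {f 0, f L}"
proof
  assume end_value: "f s \<in> {f 0, f L}"
  have nbh: "r \<in> {0..L}" if "\<bar>s - r\<bar> < min s (L - s)" for r
    using that by auto
  have "f s = min (f 0) (f L) \<or> f s = max (f 0) (f L)"
    using end_value by auto
  moreover have seg: "min (f 0) (f L) \<le> f r \<and> f r \<le> max (f 0) (f L)" if "r \<in> {0..L}" for r
    using between[OF that] by (auto simp: closed_segment_eq_real_ivl split: if_splits)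
  ultimately have "(\<forall>r. \<bar>s - r\<bar> < min s (L - s) \<longrightarrow> f s \<le> f r) \<or> (\<forall>r. \<bar>s - r\<bar> < min s (L - s) \<longrightarrow> f r \<le> f s)"
    using nbh by metis
  then have zero: "f' s = 0"
    using DERIV_local_min[OF deriv[OF s], of "min s (L - s)"] DERIV_local_max[OF deriv[OF s], of "min s (L - s)"] s
    by auto
  have rolle: "\<exists>z. x < z \<and> z < y \<and> f' z = 0" if "x < y" "f x = f y" "0 \<le> x" "y \<le> L" for x y
  proof -
    have "\<exists>z. x < z \<and> z < y \<and> (\<lambda>h. h * f' z) = (\<lambda>v. 0)"
    proof (rule Rolle_deriv[OF that(1,2)])
      show "continuous_on {x..y} f" using continuous_on_subset[OF cont] that by auto
      show "(f has_derivative (\<lambda>h. h * f' z)) (at z)" if "x < z" "z < y" for z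
        using deriv[of z] that \<open>0 \<le> x\<close> \<open>y \<le> L\<close> by (simp add: has_field_derivative_def mult_commute_abs)
    qed
    then show ?thesis by (metis mult_1)
  qed
  from end_value consider "f 0 = f s" | "f s = f L" by auto
  then show False
  proof cases
    case 1
    then obtain z where "0 < z" "z < s" "f' z = 0" using rolle[of 0 s] s by auto
    then show False using unique[of z s] zero s by simp
  next
    case 2
    then obtain z where "s < z" "z < L" "f' z = 0" using rolle[of s L] s by auto
    then show False using unique[of z s] zero s by simp
  qed
qed

text \<open>\<open>s\<close> is the arc length on BD measured from B, and the ends of the lift are
  opposite corners of the rectangle. As \<open>k\<close> stands for \<open>a - m\<close>, the
  excluded values 0 and \<open>c^2\<close> belong to the degenerate members \<open>m = a\<close> and
  \<open>m = b\<close> of the family.\<close>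

locale lifted_line =
  fixes c k L :: real and e B :: complex and W :: "real \<Rightarrow> complex"
  assumes c_pos: "c > 0" and L_pos: "L > 0" and unit: "cmod e = 1"
    and cont: "continuous_on {0..L} W"
    and lift: "\<And>s. s \<in> {0..L} \<Longrightarrow> of_real c * cosh (W s) = B + of_real s * e"
    and inside: "\<And>s. s \<in> {0..L} \<Longrightarrow> W s \<in> rectangle (Re (W 0)) (Re (W L)) (Im (W 0)) (Im (W L))"
    and nonfocal: "\<And>w. w \<in> rectangle (Re (W 0)) (Re (W L)) (Im (W 0)) (Im (W L)) \<Longrightarrow> sinh w \<noteq> 0"
    and k: "k = c\<^sup>2 * (Re e)\<^sup>2 + (Im (e * cnj B))\<^sup>2" and k_neq: "k \<noteq> 0" "k \<noteq> c\<^sup>2"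
begin



text \<open>\<open>\<omega>\<close> is the velocity of the lift with respect to the time \<open>ds / h\<close>.\<close>

definition \<omega> :: "real \<Rightarrow> complex" where
  "\<omega> s = of_real c * e * sinh (cnj (W s))"

definition h :: "real \<Rightarrow> real" where
  "h s = (c * cmod (sinh (W s)))\<^sup>2"

lemma e_unit: "e * cnj e = 1" "(Re e)\<^sup>2 + (Im e)\<^sup>2 = 1"
  using unit complex_norm_square[of e] by (simp_all add: cmod_power2[symmetric])

lemma h_pos: "s \<in> {0..L} \<Longrightarrow> h s > 0"
  using c_pos nonfocal[OF inside] by (simp add: h_def)

lemma h_eq: "of_real (h s) = of_real c^2 * sinh (W s) * sinh (cnj (W s))"
  unfolding h_def sinh_cnj using complex_norm_square[of "sinh (W s)"]
  by (simp add: power_mult_distrib)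

lemma W_deriv: assumes "0 < s" "s < L" shows "(W has_vector_derivative \<omega> s / of_real (h s)) (at s)"
proof -
  have s: "s \<in> {0..L}" using assms by simp
  have nz: "sinh (W s) \<noteq> 0" "sinh (cnj (W s)) \<noteq> 0" using nonfocal[OF inside[OF s]] by (auto simp: sinh_cnj)
  have "((\<lambda>s. (B + of_real s * e) / of_real c) has_vector_derivative e / of_real c) (at s)"
    using c_pos by (auto simp: has_vector_derivative_complex_iff intro!: derivative_eq_intros)
  then have "((\<lambda>s. cosh (W s)) has_vector_derivative e / of_real c) (at s)"
  proof (rule has_vector_derivative_transform_within_open[of _ _ _ "{0<..<L}"])
    show "(B + of_real r * e) / of_real c = cosh (W r)" if "r \<in> {0<..<L}" for r
      using lift[of r] that c_pos by (simp add: field_simps)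
  qed (use assms in auto)
  moreover have "isCont W s"
    by (rule continuous_on_interior[OF cont]) (use assms in auto)
  ultimately have "(W has_vector_derivative e / of_real c / sinh (W s)) (at s)"
    using nz by (intro cosh_lift_deriv)
  moreover have "e / of_real c / sinh (W s) = \<omega> s / of_real (h s)"
    unfolding h_eq \<omega>_def using nz c_pos by (simp add: field_simps power2_eq_square)
  ultimately show ?thesis by simp
qed

text \<open>The direction enters only through \<open>e * cnj e = 1\<close>. After multiplication by
  \<open>h\<close>, that is, with respect to time, the derivative is the expression that splits into
  a function of u and a function of v.\<close>

lemma \<omega>_deriv:
  assumes "0 < s" "s < L"
  shows "(\<omega> has_vector_derivative of_real (c\<^sup>2) * (sinh (W s) * cosh (cnj (W s))) / of_real (h s)) (at s)"
proof -
  have "((\<lambda>s. cnj (W s)) has_vector_derivative cnj (\<omega> s / of_real (h s))) (at s)"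
    using bounded_linear.has_vector_derivative[OF bounded_linear_cnj W_deriv[OF assms]] .
  moreover have "((\<lambda>z. of_real c * e * sinh z) has_field_derivative of_real c * e * cosh (cnj (W s))) (at (cnj (W s)))"
    by (auto intro!: derivative_eq_intros)
  ultimately have "(\<omega> has_vector_derivative cnj (\<omega> s / of_real (h s)) * (of_real c * e * cosh (cnj (W s)))) (at s)"
    unfolding \<omega>_def[abs_def] using field_vector_diff_chain_at by (fastforce simp: o_def)
  moreover have "cnj (\<omega> s / of_real (h s)) * (of_real c * e * cosh (cnj (W s))) =
      (e * cnj e) * (of_real (c\<^sup>2) * (sinh (W s) * cosh (cnj (W s))) / of_real (h s))"
    by (simp add: \<omega>_def sinh_cnj power2_eq_square)
  ultimately show ?thesis by (simp only: e_unit mult_1_left)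
qed

lemma \<omega>_continuous: "continuous_on {0..L} \<omega>"
  unfolding \<omega>_def[abs_def] by (intro continuous_intros cont)

lemma \<omega>_squared:
  assumes "s \<in> {0..L}"
  shows "(Re (\<omega> s))\<^sup>2 = c\<^sup>2 * (cosh (Re (W s)))\<^sup>2 - k"
    and "(Im (\<omega> s))\<^sup>2 = k - c\<^sup>2 * (cos (Im (W s)))\<^sup>2"
proof -
  \<comment> \<open>Moving along the line adds the real number \<open>s\<close>, so the imaginary
    part, the angular momentum about the centre, does not change.\<close>
  have "e * cnj (of_real c * cosh (W s)) = e * cnj B + of_real s"
    unfolding lift[OF assms] using e_unit(1) by (simp add: algebra_simps)
  then have "k = c\<^sup>2 * (Re e)\<^sup>2 + (Im (e * cnj (of_real c * cosh (W s))))\<^sup>2"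
    by (simp add: k)
  then show "(Re (\<omega> s))\<^sup>2 = c\<^sup>2 * (cosh (Re (W s)))\<^sup>2 - k" "(Im (\<omega> s))\<^sup>2 = k - c\<^sup>2 * (cos (Im (W s)))\<^sup>2"
    unfolding \<omega>_def using momentum_of_direction[OF unit, of c "W s"] by simp_all
qed

text \<open>The left side is the imaginary part of \<open>\<omega>^2\<close>. Replacing
  \<open>sinh^2\<close> by \<open>cosh^2 - 1\<close> makes \<open>\<omega>^2\<close> a quadratic
  polynomial in \<open>s\<close> with leading coefficient 1, so that its imaginary part has no
  quadratic term.\<close>

lemma \<omega>_product:
  assumes "s \<in> {0..L}"
  shows "2 * (Re (\<omega> s) * Im (\<omega> s)) = Im ((e * cnj B)\<^sup>2 - (of_real c * e)\<^sup>2) + 2 * s * Im (e * cnj B)"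
proof -
  have "(\<omega> s)\<^sup>2 = e\<^sup>2 * (cnj (of_real c * cosh (W s)))\<^sup>2 - (of_real c * e)\<^sup>2"
    by (simp add: \<omega>_def power_mult_distrib sinh_square_eq cosh_cnj algebra_simps)
  also have "e\<^sup>2 * (cnj (of_real c * cosh (W s)))\<^sup>2 = (e * cnj B + of_real s * (e * cnj e))\<^sup>2"
    unfolding lift[OF assms] by (simp add: algebra_simps power2_eq_square)
  finally have "Im ((\<omega> s)\<^sup>2) = Im ((e * cnj B + of_real s)\<^sup>2 - (of_real c * e)\<^sup>2)"
    by (simp add: e_unit)
  then show ?thesis
    by (simp add: power2_eq_square algebra_simps)
qed

text \<open>By the previous lemma the product is affine in \<open>s\<close>; it vanishes where the line touches the
  caustic.\<close>

lemma \<omega>_product_zero_unique: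
  assumes "r \<in> {0..L}" "s \<in> {0..L}" "Re (\<omega> r) * Im (\<omega> r) = 0" "Re (\<omega> s) * Im (\<omega> s) = 0"
  shows "r = s"
proof (rule ccontr)
  assume "r \<noteq> s"
  have *: "Im ((e * cnj B)\<^sup>2 - (of_real c * e)\<^sup>2) + 2 * r * Im (e * cnj B) = 0"
    "Im ((e * cnj B)\<^sup>2 - (of_real c * e)\<^sup>2) + 2 * s * Im (e * cnj B) = 0"
    using \<omega>_product[of r] \<omega>_product[of s] assms by simp_all
  \<comment> \<open>An affine function with two zeros vanishes identically. The line then passes
    through the centre in the direction of a coordinate axis, which forces an excluded value of
    \<open>k\<close>.\<close>
  then have "(r - s) * Im (e * cnj B) = 0" by algebra
  then have cross: "Im (e * cnj B) = 0" using \<open>r \<noteq> s\<close> by simp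
  then have "Im ((e * cnj B)\<^sup>2) = 0" by (simp add: Im_power2)
  then have "Im ((of_real c * e)\<^sup>2) = 0" using * cross by simp
  then have "Re e = 0 \<or> Im e = 0" using c_pos by (simp add: Im_power2)
  then show False
    using k k_neq cross e_unit(2) by auto
qed

lemma Re_W_deriv: "0 < s \<Longrightarrow> s < L \<Longrightarrow> ((\<lambda>s. Re (W s)) has_real_derivative Re (\<omega> s) / h s) (at s)"
  and Im_W_deriv: "0 < s \<Longrightarrow> s < L \<Longrightarrow> ((\<lambda>s. Im (W s)) has_real_derivative Im (\<omega> s) / h s) (at s)"
  using W_deriv[of s] by (simp_all add: has_vector_derivative_complex_iff)

lemma interior_coordinates:
  assumes "0 < s" "s < L"
  shows "Re (W s) \<notin> {Re (W 0), Re (W L)}" "Im (W s) \<notin> {Im (W 0), Im (W L)}"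
proof -
  have uniq: "r = s" if "0 < r" "r < L" "0 < s" "s < L" "Re (\<omega> r) * Im (\<omega> r) = 0" "Re (\<omega> s) * Im (\<omega> s) = 0" for r s
    using \<omega>_product_zero_unique[of r s] that by simp
  have hn: "h r \<noteq> 0" if "0 < r" "r < L" for r
    using h_pos[of r] that by simp
  have seg: "Re (W s) \<in> closed_segment (Re (W 0)) (Re (W L))" "Im (W s) \<in> closed_segment (Im (W 0)) (Im (W L))"
    if "s \<in> {0..L}" for s
    using inside[OF that] by (simp_all add: rectangle_def)
  show "Re (W s) \<notin> {Re (W 0), Re (W L)}"
    by (rule unique_critical_point_interior[OF _ Re_W_deriv _ _ assms])
      (use cont seg uniq hn in \<open>auto intro!: continuous_intros\<close>)
  show "Im (W s) \<notin> {Im (W 0), Im (W L)}"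
    by (rule unique_critical_point_interior[OF _ Im_W_deriv _ _ assms])
      (use cont seg uniq hn in \<open>auto intro!: continuous_intros\<close>)
qed

text \<open>The line runs from \<open>B\<close> to \<open>D\<close>, an antidiagonal of the square, so \<open>V\<close> is traversed backwards.\<close>

lemma separated_flow_exists:
  obtains T U V pu pv where "separated_flow c k T U V pu pv"
    "U 0 = Re (W 0)" "U T = Re (W L)" "V 0 = Im (W L)" "V T = Im (W 0)"
    "\<And>x y. x \<in> {0..T} \<Longrightarrow> y \<in> {0..T} \<Longrightarrow>
      Complex (U x) (V y) \<in> rectangle (Re (W 0)) (Re (W L)) (Im (W 0)) (Im (W L))"
    "\<And>x. 0 < x \<Longrightarrow> x < T \<Longrightarrow> U x \<notin> {U 0, U T} \<and> V x \<notin> {V 0, V T}"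
proof -
  define \<theta> where "\<theta> s = integral {0..s} (\<lambda>s. 1 / h s)" for s
  have hc: "continuous_on {0..L} (\<lambda>s. 1 / h s)"
    using h_pos unfolding h_def[abs_def] by (intro continuous_intros cont) fastforce
  have \<theta>_deriv: "(\<theta> has_real_derivative 1 / h s) (at s)" if "0 < s" "s < L" for s
  proof -
    have "(\<theta> has_real_derivative 1 / h s) (at s within {0..L})"
      unfolding \<theta>_def by (rule integral_has_real_derivative[OF hc]) (use that in auto)
    then show ?thesis using that at_within_Icc_at by metis
  qed
  have "continuous_on {0..L} \<theta>"
    unfolding \<theta>_def by (intro indefinite_integral_continuous_1 integrable_continuous_real hc)
  moreover have "\<theta> 0 = 0" by (simp add: \<theta>_def)
  moreover have "h s > 0" if "0 < s" "s < L" for s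
    using h_pos[of s] that by simp
  ultimately obtain \<rho> where T: "\<theta> L > 0" and \<rho>: "continuous_on {0..\<theta> L} \<rho>" "\<rho> 0 = 0" "\<rho> (\<theta> L) = L"
    "\<And>t. t \<in> {0..\<theta> L} \<Longrightarrow> \<rho> t \<in> {0..L}"
    "\<And>t. 0 < t \<Longrightarrow> t < \<theta> L \<Longrightarrow> 0 < \<rho> t \<and> \<rho> t < L"
    "\<And>t. 0 < t \<Longrightarrow> t < \<theta> L \<Longrightarrow> (\<rho> has_real_derivative h (\<rho> t)) (at t)"
    using real_inverse_flow[where h = h and \<theta> = \<theta>, OF L_pos _ _ \<theta>_deriv] by blast
  define T where "T = \<theta> L"
  note T = T[folded T_def] and \<rho> = \<rho>[folded T_def]
  define X where "X t = W (\<rho> t)" for t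
  define \<Omega> where "\<Omega> t = \<omega> (\<rho> t)" for t
  have X_cont: "continuous_on {0..T} X" and \<Omega>_cont: "continuous_on {0..T} \<Omega>"
    unfolding X_def \<Omega>_def
    by (rule continuous_on_compose2[OF cont \<rho>(1)] continuous_on_compose2[OF \<omega>_continuous \<rho>(1)]; use \<rho>(4) in blast)+
  have flip: "continuous_on {0..T} (\<lambda>t. f (T - t))" if "continuous_on {0..T} f" for f :: "real \<Rightarrow> complex"
    by (rule continuous_on_compose2[OF that]) (auto intro!: continuous_intros)
  have X_deriv: "(X has_vector_derivative \<Omega> t) (at t)" if t: "0 < t" "t < T" for t
  proof -
    note r = \<rho>(5)[OF t]
    have "((W \<circ> \<rho>) has_vector_derivative h (\<rho> t) *\<^sub>R (\<omega> (\<rho> t) / of_real (h (\<rho> t)))) (at t)"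
      using \<rho>(6)[OF t] W_deriv[of "\<rho> t"] r
      by (intro vector_diff_chain_at) (auto simp: has_real_derivative_iff_has_vector_derivative)
    then show ?thesis
      using h_pos[of "\<rho> t"] r by (simp add: X_def[abs_def] \<Omega>_def o_def scaleR_conv_of_real)
  qed
  have \<Omega>_deriv: "(\<Omega> has_vector_derivative of_real (c\<^sup>2) * (sinh (X t) * cosh (cnj (X t)))) (at t)"
    if t: "0 < t" "t < T" for t
  proof -
    note r = \<rho>(5)[OF t]
    have "((\<omega> \<circ> \<rho>) has_vector_derivative h (\<rho> t) *\<^sub>R (of_real (c\<^sup>2) * (sinh (W (\<rho> t)) * cosh (cnj (W (\<rho> t)))) / of_real (h (\<rho> t)))) (at t)"
      using \<rho>(6)[OF t] \<omega>_deriv[of "\<rho> t"] r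
      by (intro vector_diff_chain_at) (auto simp: has_real_derivative_iff_has_vector_derivative)
    then show ?thesis
      using h_pos[of "\<rho> t"] r by (simp add: X_def \<Omega>_def[abs_def] o_def scaleR_conv_of_real)
  qed
  have X_inside: "X t \<in> rectangle (Re (W 0)) (Re (W L)) (Im (W 0)) (Im (W L))" if "t \<in> {0..T}" for t
    unfolding X_def by (rule inside[OF \<rho>(4)[OF that]])
  \<comment> \<open>Reversing the time of the v-motion negates its momentum but not its
    acceleration, so the second-order equation keeps its form.\<close>
  define U V pu pv where "U t = Re (X t)" and "V t = Im (X (T - t))"
    and "pu t = Re (\<Omega> t)" and "pv t = - Im (\<Omega> (T - t))" for t
  note defs = U_def V_def pu_def pv_def
  have rect: "Complex (U x) (V y) \<in> rectangle (Re (W 0)) (Re (W L)) (Im (W 0)) (Im (W L))"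
    if "x \<in> {0..T}" "y \<in> {0..T}" for x y
    using X_inside[of x] X_inside[of "T - y"] that by (simp add: rectangle_def defs)
  have reverse: "((\<lambda>t. T - t) has_real_derivative - 1) (at y)" for y
    by (auto intro!: derivative_eq_intros)
  have flow: "separated_flow c k T U V pu pv"
  proof
    show "continuous_on {0..T} U" "continuous_on {0..T} V" "continuous_on {0..T} pu" "continuous_on {0..T} pv"
      unfolding defs by (intro continuous_intros X_cont \<Omega>_cont flip)+
    show "(U has_real_derivative pu x) (at x)" if "0 < x" "x < T" for x
      using X_deriv[OF that] unfolding defs by (simp add: has_vector_derivative_complex_iff)
    show "(pu has_real_derivative c\<^sup>2 * (cosh (U x) * sinh (U x))) (at x)" if "0 < x" "x < T" for x
      using \<Omega>_deriv[OF that] unfolding defs sinh_times_cosh_cnj by (simp add: has_vector_derivative_complex_iff)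
    show "(V has_real_derivative pv y) (at y)" if "0 < y" "y < T" for y
    proof -
      have "((\<lambda>t. Im (X t)) has_real_derivative Im (\<Omega> (T - y))) (at (T - y))"
        using X_deriv[of "T - y"] that by (simp add: has_vector_derivative_complex_iff)
      from DERIV_chain2[OF this reverse] show ?thesis by (simp add: V_def[abs_def] pv_def)
    qed
    show "(pv has_real_derivative c\<^sup>2 * (cos (V y) * sin (V y))) (at y)" if "0 < y" "y < T" for y
    proof -
      have "((\<lambda>t. Im (\<Omega> t)) has_real_derivative c\<^sup>2 * (cos (Im (X (T - y))) * sin (Im (X (T - y))))) (at (T - y))"
        using \<Omega>_deriv[of "T - y"] that unfolding sinh_times_cosh_cnj by (simp add: has_vector_derivative_complex_iff)
      from DERIV_minus[OF DERIV_chain2[OF this reverse]] show ?thesis by (simp add: pv_def[abs_def] V_def)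
    qed
    show "(pu x)\<^sup>2 = c\<^sup>2 * (cosh (U x))\<^sup>2 - k" if "x \<in> {0..T}" for x
      using \<omega>_squared(1)[OF \<rho>(4)[OF that]] by (simp add: defs X_def \<Omega>_def)
    show "(pv y)\<^sup>2 = k - c\<^sup>2 * (cos (V y))\<^sup>2" if "y \<in> {0..T}" for y
      using \<omega>_squared(2)[OF \<rho>(4)[of "T - y"]] that by (simp add: defs X_def \<Omega>_def)
    show "sinh (Complex (U x) (V y)) \<noteq> 0" if "x \<in> {0..T}" "y \<in> {0..T}" for x y
      by (rule nonfocal[OF rect[OF that]])
  qed (use c_pos T in auto)
  have ends: "U 0 = Re (W 0)" "U T = Re (W L)" "V 0 = Im (W L)" "V T = Im (W 0)"
    by (simp_all add: defs X_def \<rho>)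
  have "U x \<notin> {U 0, U T} \<and> V x \<notin> {V 0, V T}" if "0 < x" "x < T" for x
    using interior_coordinates[of "\<rho> x"] interior_coordinates[of "\<rho> (T - x)"] \<rho>(5)[of x] \<rho>(5)[of "T - x"] that
    unfolding ends by (auto simp: defs X_def)
  then show ?thesis using that[OF flow ends rect] by blast
qed

end

section \<open>The theorem\<close>

text \<open>For a fixed point the equation of the conic, cleared of denominators, is quadratic in
  \<open>l\<close>; the elliptic coordinates of the point give its two roots.\<close>

lemma conic_iff:
  assumes ab: "a - b = c\<^sup>2" and c: "c > 0" and l: "l \<noteq> a" "l \<noteq> b"
  shows "pt (of_real c * cosh w) \<in> conic a b l \<longleftrightarrow>
    l = a - c\<^sup>2 * (cosh (Re w))\<^sup>2 \<or> l = a - c\<^sup>2 * (cos (Im w))\<^sup>2"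
proof -
  define C D where "C = (cosh (Re w))\<^sup>2" and "D = (cos (Im w))\<^sup>2"
  have nz: "a - l \<noteq> 0" "b - l \<noteq> 0" using l by auto
  have frac: "p / A + q / B = (B * p + A * q) / (A * B)" if "A \<noteq> 0" "B \<noteq> 0" for p q A B :: real
    using that by (simp add: field_simps)
  have "pt (of_real c * cosh w) \<in> conic a b l \<longleftrightarrow>
      (c * (cosh (Re w) * cos (Im w)))\<^sup>2 / (a - l) + (c * (sinh (Re w) * sin (Im w)))\<^sup>2 / (b - l) = 1"
    by (simp add: conic_def pt_def Re_cosh Im_cosh)
  also have "\<dots> \<longleftrightarrow> (b - l) * (c\<^sup>2 * (C * D)) + (a - l) * (c\<^sup>2 * ((C - 1) * (1 - D))) = (a - l) * (b - l)"
    unfolding frac[OF nz] using nz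
    by (auto simp: C_def D_def power_mult_distrib sinh_square_eq sin_squared_eq)
  also have "\<dots> \<longleftrightarrow> (a - l - c\<^sup>2 * C) * (a - l - c\<^sup>2 * D) = 0"
    using ab by algebra
  finally show ?thesis by (auto simp: C_def D_def)
qed

lemma cosh_squared_ge_1: "(cosh (x::real))\<^sup>2 \<ge> 1"
  using cosh_real_ge_1[of x] by (simp add: one_le_power)

text \<open>The root given by u is at most \<open>b\<close> and the root given by v is at least
  \<open>b\<close>, so the type of the conic decides which root \<open>l\<close> is.\<close>

lemma ellipse_coordinate:
  assumes "a - b = c\<^sup>2" "c > 0" "is_ellipse b l" "pt (of_real c * cosh w) \<in> conic a b l"
  shows "l = a - c\<^sup>2 * (cosh (Re w))\<^sup>2"
proof -
  have "c\<^sup>2 * (cos (Im w))\<^sup>2 \<le> c\<^sup>2 * 1"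
    by (intro mult_left_mono) (auto simp: cos_squared_eq)
  moreover have "l < b" "0 < c\<^sup>2" using assms(2,3) by (simp_all add: is_ellipse_def)
  moreover from this have "l \<noteq> a" "l \<noteq> b" using assms(1) by linarith+
  ultimately show ?thesis
    using assms(1,4) conic_iff[OF assms(1,2), of l w] by linarith
qed

lemma hyperbola_coordinate:
  assumes "a - b = c\<^sup>2" "c > 0" "is_hyperbola a b l" "pt (of_real c * cosh w) \<in> conic a b l"
  shows "l = a - c\<^sup>2 * (cos (Im w))\<^sup>2"
proof -
  have "c\<^sup>2 * (cosh (Re w))\<^sup>2 \<ge> c\<^sup>2 * 1"
    by (intro mult_left_mono cosh_squared_ge_1) auto
  moreover have "b < l" "l < a" using assms(3) by (simp_all add: is_hyperbola_def)
  ultimately show ?thesis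
    using assms(1,4) conic_iff[OF assms(1,2), of l w] by linarith
qed

text \<open>Named so that the transposition of the table can act on the whole family.\<close>

definition trajectory_family ::
    "real \<Rightarrow> real \<Rightarrow> real \<Rightarrow> real \<Rightarrow> real \<Rightarrow> real \<Rightarrow> real \<Rightarrow> (point \<Rightarrow> point) \<Rightarrow>
     point \<Rightarrow> point \<Rightarrow> point \<Rightarrow> point \<Rightarrow> bool" where
  "trajectory_family a b m lAB lBC lCD lDA F A B C D \<longleftrightarrow>
    (\<exists>P Q R S :: real \<Rightarrow> point.
            continuous_on {0..1} P \<and> continuous_on {0..1} Q \<and>
            continuous_on {0..1} R \<and> continuous_on {0..1} S \<and>
            P 0 = B \<and> Q 0 = B \<and> R 0 = D \<and> S 0 = D \<and>
            P 1 = A \<and> Q 1 = C \<and> R 1 = C \<and> S 1 = A \<and>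
            (\<forall>t \<in> {0<..<1}.
               billiard_trajectory a b lAB lBC lCD lDA F (P t) (Q t) (R t) (S t) \<and>
               rays_tangent a b m (P t) (Q t) (R t) (S t)) \<and>
            (\<forall>s \<in> {0..1}. \<forall>t \<in> {0..1}.
               perimeter (P s) (Q s) (R s) (S s) = perimeter (P t) (Q t) (R t) (S t)))"

text \<open>With AB on an ellipse, u is constant on AB and CD and v on BC and DA. The other type of
  table is the transpose of one of this type.\<close>

lemma ellipse_first:
  fixes a b m lAB lBC lCD lDA :: real
    and F :: "point \<Rightarrow> point" and A B C D :: point
  assumes "a > b" and "b > 0"
    and quad: "confocal_quadrilateral a b lAB lBC lCD lDA F" and "is_ellipse b lAB"
    and corners: "A = F (0, 0)" "B = F (1, 0)" "C = F (1, 1)" "D = F (0, 1)"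
    and BD: "closed_segment B D \<subseteq> table F"
    and m: "is_ellipse b m \<or> is_hyperbola a b m"
    and tangent: "tangent_to_conic a b m (affine hull {B, D})"
  shows "trajectory_family a b m lAB lBC lCD lDA F A B C D \<and>
         tangent_to_conic a b m (affine hull {A, C}) \<and>
         dist A C = dist B D"
proof -
  define c where "c = sqrt (a - b)"
  have c: "c > 0" and ab: "a - b = c\<^sup>2" using \<open>a > b\<close> by (simp_all add: c_def)
  have types: "is_ellipse b lAB" "is_hyperbola a b lBC" "is_ellipse b lCD" "is_hyperbola a b lDA"
    and contF: "continuous_on unit_square F" and injF: "inj_on F unit_square"
    and sides: "side_AB F \<subseteq> conic a b lAB" "side_BC F \<subseteq> conic a b lBC"
      "side_CD F \<subseteq> conic a b lCD" "side_DA F \<subseteq> conic a b lDA"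
    and foci: "(c, 0) \<notin> table F" "(- c, 0) \<notin> table F"
    using quad \<open>is_ellipse b lAB\<close>
    by (auto simp: confocal_quadrilateral_def is_ellipse_def is_hyperbola_def c_def)

  \<comment> \<open>Dividing by \<open>c\<close> moves the foci to 1 and -1, the branch values of
    \<open>cosh\<close>.\<close>
  define f where "f p = Complex (fst (F p) / c) (snd (F p) / c)" for p
  have "continuous_on unit_square f"
    unfolding f_def Complex_eq using c by (intro continuous_intros contF) auto
  moreover have "contractible unit_square"
    unfolding unit_square_def by (intro convex_imp_contractible convex_Times) auto
  moreover have "f p \<noteq> 1 \<and> f p \<noteq> -1" if "p \<in> unit_square" for p
  proof -
    have "F p \<in> table F" using that by (simp add: table_def)
    then have "F p \<noteq> (c, 0)" "F p \<noteq> (- c, 0)" using foci by auto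
    then show ?thesis using c by (auto simp: f_def complex_eq_iff prod_eq_iff field_simps)
  qed
  ultimately obtain G where contG: "continuous_on unit_square G"
    and "\<And>p. p \<in> unit_square \<Longrightarrow> f p = cosh (G p)"
    using continuous_cosh_lift by metis
  then have FG: "F p = pt (of_real c * cosh (G p))" if "p \<in> unit_square" for p
    using that c by (simp add: f_def complex_eq_iff pt_def prod_eq_iff field_simps flip: \<open>\<And>p. p \<in> unit_square \<Longrightarrow> f p = cosh (G p)\<close>)
  have injG: "inj_on G unit_square"
    using injF FG by (auto simp: inj_on_def)

  have sq: "(s, 0) \<in> unit_square" "(1, s) \<in> unit_square" "(s, 1) \<in> unit_square" "(0, s) \<in> unit_square"
    if "s \<in> {0..1}" for s
    using that by (auto simp: unit_square_def)
  have coords: "lAB = a - c\<^sup>2 * (cosh (Re (G (s, 0))))\<^sup>2" "lBC = a - c\<^sup>2 * (cos (Im (G (1, s))))\<^sup>2"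
    "lCD = a - c\<^sup>2 * (cosh (Re (G (s, 1))))\<^sup>2" "lDA = a - c\<^sup>2 * (cos (Im (G (0, s))))\<^sup>2"
    if "s \<in> {0..1}" for s
    using that sides sq[OF that]
    by (auto intro!: ellipse_coordinate[OF ab c types(1)] hyperbola_coordinate[OF ab c types(2)]
        ellipse_coordinate[OF ab c types(3)] hyperbola_coordinate[OF ab c types(4)]
        simp: side_AB_def side_BC_def side_CD_def side_DA_def simp flip: FG)
  have contside: "continuous_on {0..1} (\<lambda>s. G (s, r))" "continuous_on {0..1} (\<lambda>s. G (r, s))"
    if "r \<in> {0..1}" for r
    by (rule continuous_on_compose2[OF contG]; use that in \<open>auto intro!: continuous_intros simp: unit_square_def\<close>)+
  \<comment> \<open>The conic determines u only up to sign, and v below up to sign and multiples of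
    pi. Along a connected side this ambiguity is frozen, since a nondegenerate conic avoids the
    critical points of \<open>cosh^2\<close> and \<open>cos^2\<close>.\<close>
  have u_const: "Re (g s) = Re (g r)"
    if "is_ellipse b l" "continuous_on {0..1::real} g" "\<And>s. s \<in> {0..1} \<Longrightarrow> l = a - c\<^sup>2 * (cosh (Re (g s)))\<^sup>2"
      "s \<in> {0..1}" "r \<in> {0..1}" for g :: "real \<Rightarrow> complex" and l s r
  proof (rule connected_level_set_constant[where S = "{0..1}" and g = "\<lambda>x. Re (g x)" and f = "\<lambda>u. a - c\<^sup>2 * (cosh u)\<^sup>2" and f' = "\<lambda>u. - (c\<^sup>2 * (2 * cosh u * sinh u))"])
    show "((\<lambda>u. a - c\<^sup>2 * (cosh u)\<^sup>2) has_real_derivative - (c\<^sup>2 * (2 * cosh v * sinh v))) (at v)" for v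
      by (auto intro!: derivative_eq_intros)
    show "- (c\<^sup>2 * (2 * cosh (Re (g x)) * sinh (Re (g x)))) \<noteq> 0" if "x \<in> {0..1}" for x
    proof -
      have "(cosh (Re (g x)))\<^sup>2 \<noteq> 1"
        using \<open>is_ellipse b l\<close> \<open>\<And>s. s \<in> {0..1} \<Longrightarrow> l = a - c\<^sup>2 * (cosh (Re (g s)))\<^sup>2\<close>[OF that] ab
        by (auto simp: is_ellipse_def)
      then show ?thesis using c by (auto simp: cosh_square_eq)
    qed
  qed (use that in \<open>auto intro!: continuous_intros\<close>)
  have v_const: "Im (g s) = Im (g r)"
    if "is_hyperbola a b l" "continuous_on {0..1::real} g" "\<And>s. s \<in> {0..1} \<Longrightarrow> l = a - c\<^sup>2 * (cos (Im (g s)))\<^sup>2"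
      "s \<in> {0..1}" "r \<in> {0..1}" for g :: "real \<Rightarrow> complex" and l s r
  proof (rule connected_level_set_constant[where S = "{0..1}" and g = "\<lambda>x. Im (g x)" and f = "\<lambda>v. a - c\<^sup>2 * (cos v)\<^sup>2" and f' = "\<lambda>v. c\<^sup>2 * (2 * cos v * sin v)"])
    show "((\<lambda>v. a - c\<^sup>2 * (cos v)\<^sup>2) has_real_derivative c\<^sup>2 * (2 * cos v * sin v)) (at v)" for v
      by (auto intro!: derivative_eq_intros)
    show "c\<^sup>2 * (2 * cos (Im (g x)) * sin (Im (g x))) \<noteq> 0" if "x \<in> {0..1}" for x
    proof -
      have "(cos (Im (g x)))\<^sup>2 \<noteq> 1" "(cos (Im (g x)))\<^sup>2 \<noteq> 0"
        using \<open>is_hyperbola a b l\<close> \<open>\<And>s. s \<in> {0..1} \<Longrightarrow> l = a - c\<^sup>2 * (cos (Im (g s)))\<^sup>2\<close>[OF that] ab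
        by (auto simp: is_hyperbola_def)
      then have "cos (Im (g x)) \<noteq> 0" "sin (Im (g x)) \<noteq> 0"
        using sin_squared_eq[of "Im (g x)"] by auto
      then show ?thesis using c by simp
    qed
  qed (use that in \<open>auto intro!: continuous_intros\<close>)
  define u0 u1 v0 v1 where "u0 = Re (G (0, 0))" and "u1 = Re (G (1, 1))"
    and "v0 = Im (G (0, 0))" and "v1 = Im (G (1, 1))"
  have const: "Re (G (s, 0)) = u0" "Im (G (1, s)) = v1" "Re (G (s, 1)) = u1" "Im (G (0, s)) = v0"
    if "s \<in> {0..1}" for s
    using u_const[OF types(1) contside(1)[of 0] coords(1) that, of 0]
      v_const[OF types(2) contside(2)[of 1] coords(2) that, of 1]
      u_const[OF types(3) contside(1)[of 1] coords(3) that, of 1]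
      v_const[OF types(4) contside(2)[of 0] coords(4) that, of 0]
    by (simp_all add: u0_def u1_def v0_def v1_def)
  have image: "G ` unit_square = rectangle u0 u1 v0 v1"
    "G ` ({0..1} \<times> {0}) = {w. Re w = u0 \<and> Im w \<in> closed_segment v0 v1}"
    "G ` ({1} \<times> {0..1}) = {w. Re w \<in> closed_segment u0 u1 \<and> Im w = v1}"
    "G ` ({0..1} \<times> {1}) = {w. Re w = u1 \<and> Im w \<in> closed_segment v0 v1}"
    "G ` ({0} \<times> {0..1}) = {w. Re w \<in> closed_segment u0 u1 \<and> Im w = v0}"
    by (rule injective_image_of_square[OF contG injG]; rule const; assumption)+
  let ?R = "rectangle u0 u1 v0 v1"
  have table: "table F = (\<lambda>w. pt (of_real c * cosh w)) ` ?R"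
  proof -
    have "F ` unit_square = (\<lambda>w. pt (of_real c * cosh w)) ` G ` unit_square"
      using FG by (simp add: image_image)
    then show ?thesis by (simp only: table_def image(1))
  qed
  have inj_rect: "w = w'" if "w \<in> ?R" "w' \<in> ?R" "cosh w = cosh w'" for w w'
  proof -
    have "w \<in> G ` unit_square" "w' \<in> G ` unit_square"
      using that(1,2) by (simp_all only: image(1))
    then obtain p p' where p: "p \<in> unit_square" "w = G p" "p' \<in> unit_square" "w' = G p'"
      by blast
    then have "F p = F p'" using that(3) FG by simp
    then show ?thesis using inj_onD[OF injF] p by blast
  qed
  have nonfocal: "sinh w \<noteq> 0" if "w \<in> ?R" for w
  proof
    assume "sinh w = 0"
    then have "cosh w = 1 \<or> cosh w = -1"
      using cosh_square_eq[of w] by (simp add: power2_eq_1_iff)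
    then have "pt (of_real c * cosh w) \<in> {(c, 0), (- c, 0)}" by (auto simp: pt_def)
    then show False using foci that unfolding table by (metis image_eqI insertE singletonD)
  qed

  have unit_corners: "(0, 0) \<in> unit_square" "(1, 0) \<in> unit_square" "(1, 1) \<in> unit_square" "(0, 1) \<in> unit_square"
    by (simp_all add: unit_square_def)
  have Gc: "G (0, 0) = Complex u0 v0" "G (1, 0) = Complex u0 v1" "G (1, 1) = Complex u1 v1" "G (0, 1) = Complex u1 v0"
    using const[of 0] const[of 1] by (simp_all add: complex_eq_iff)
  define zB zD where "zB = of_real c * cosh (Complex u0 v1)" and "zD = of_real c * cosh (Complex u1 v0)"
  have zBD: "B = pt zB" "D = pt zD"
    using FG unit_corners by (simp_all add: corners zB_def zD_def Gc)
  have "B \<noteq> D"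
    using injF unit_corners unfolding corners by (metis inj_onD prod.inject zero_neq_one)
  then have "zB \<noteq> zD" by (simp add: zBD)
  define L e where "L = cmod (zD - zB)" and "e = (zD - zB) / of_real L"
  have L: "L > 0" using \<open>zB \<noteq> zD\<close> by (simp add: L_def)
  have e: "cmod e = 1" "zD = zB + of_real L * e"
    using L by (simp_all add: e_def L_def norm_divide)
  \<comment> \<open>Elliptic coordinates on the table. They are continuous as the inverse of a
    continuous injection of a compact rectangle, and they lift BD because it lies in the
    table.\<close>
  define H where "H = the_inv_into ?R (\<lambda>w. pt (of_real c * cosh w))"
  have injz: "inj_on (\<lambda>w. pt (of_real c * cosh w)) ?R"
    using inj_rect c by (auto simp: inj_on_def)
  have "compact ?R" unfolding rectangle_eq_cbox by simp
  then have contH: "continuous_on (table F) H"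
    unfolding H_def table
    by (intro continuous_on_inv_into injz continuous_intros)
  have H: "H p \<in> ?R" "pt (of_real c * cosh (H p)) = p" if "p \<in> table F" for p
    using that the_inv_into_into[OF injz, of p ?R] f_the_inv_into_f[OF injz, of p] by (auto simp: H_def table)
  have H_eq: "H (pt (of_real c * cosh w)) = w" if "w \<in> ?R" for w
    using the_inv_into_f_f[OF injz that] by (simp add: H_def)
  define W where "W s = H (pt (zB + of_real s * e))" for s
  have line: "pt (zB + of_real s * e) \<in> table F" if "s \<in> {0..L}" for s
  proof -
    have "zB + of_real s * e = (1 - s / L) *\<^sub>R zB + (s / L) *\<^sub>R zD"
      using L by (simp add: e(2) scaleR_conv_of_real field_simps)
    then have "zB + of_real s * e \<in> closed_segment zB zD"
      using that L by (auto simp: in_segment intro!: exI[of _ "s / L"])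
    then have "pt (zB + of_real s * e) \<in> closed_segment B D"
      unfolding zBD segment_pt by (rule imageI)
    then show ?thesis using BD by auto
  qed
  have inR: "Complex u0 v1 \<in> ?R" "Complex u1 v0 \<in> ?R" by (simp_all add: rectangle_def)
  have W0: "W 0 = Complex u0 v1" and WL: "W L = Complex u1 v0"
    unfolding W_def e(2)[symmetric] unfolding zB_def zD_def using inR by (simp_all add: H_eq)
  have rect: "rectangle (Re (W 0)) (Re (W L)) (Im (W 0)) (Im (W L)) = ?R"
    by (simp add: W0 WL rectangle_def closed_segment_commute)
  have m_neq: "m \<noteq> a" "m \<noteq> b"
    using m \<open>a > b\<close> by (auto simp: is_ellipse_def is_hyperbola_def)
  \<comment> \<open>The tangency of BD to the given conic fixes the value of Joachimsthal's
    integral.\<close>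
  have k: "a - m = c\<^sup>2 * (Re e)\<^sup>2 + (Im (e * cnj zB))\<^sup>2"
    using tangent_to_conic_direction[OF ab m_neq e(2) _ e(1)] tangent L unfolding zBD by auto
  interpret lifted_line c "a - m" L e zB W
  proof
    show "continuous_on {0..L} W"
      unfolding W_def by (rule continuous_on_compose2[OF contH]) (use line in \<open>auto intro!: continuous_intros\<close>)
    show "of_real c * cosh (W s) = zB + of_real s * e" if "s \<in> {0..L}" for s
      using H(2)[OF line[OF that]] by (simp add: W_def)
    show "W s \<in> rectangle (Re (W 0)) (Re (W L)) (Im (W 0)) (Im (W L))" if "s \<in> {0..L}" for s
      unfolding rect using H(1)[OF line[OF that]] by (simp add: W_def)
    show "sinh w \<noteq> 0" if "w \<in> rectangle (Re (W 0)) (Re (W L)) (Im (W 0)) (Im (W L))" for w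
      using nonfocal that unfolding rect by blast
    show "a - m \<noteq> c\<^sup>2" using m_neq ab by auto
  qed (use c L e k m_neq in auto)
  obtain T U V pu pv where flow: "separated_flow c (a - m) T U V pu pv"
    and uv_ends: "U 0 = u0" "U T = u1" "V 0 = v0" "V T = v1"
    and in_rect: "\<And>x y. x \<in> {0..T} \<Longrightarrow> y \<in> {0..T} \<Longrightarrow> Complex (U x) (V y) \<in> ?R"
    and interior: "\<And>x. 0 < x \<Longrightarrow> x < T \<Longrightarrow> U x \<notin> {U 0, U T} \<and> V x \<notin> {V 0, V T}"
    by (rule separated_flow_exists[unfolded rect, unfolded W0 WL complex.sel]) (rule that)
  interpret separated_flow c "a - m" T U V pu pv by (rule flow)
  have T0: "0 \<in> {0..T}" "T \<in> {0..T}" using T_pos by auto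
  have F_corner: "A = pt (node 0 0)" "B = pt (node 0 T)" "C = pt (node T T)" "D = pt (node T 0)"
    using FG unit_corners by (simp_all add: corners node_def uv_ends Gc)
  have in_side: "pt (of_real c * cosh w) \<in> F ` X" if "w \<in> G ` X" "X \<subseteq> unit_square" for w X
    using that FG by (metis imageE image_eqI subsetD)
  have sub: "{0..1} \<times> {0} \<subseteq> unit_square" "{1} \<times> {0..1} \<subseteq> unit_square"
    "{0..1} \<times> {1} \<subseteq> unit_square" "{0} \<times> {0..1} \<subseteq> unit_square"
    by (auto simp: unit_square_def)
  have UV: "U x \<in> closed_segment u0 u1" "V x \<in> closed_segment v0 v1" if "x \<in> {0..T}" for x
    using in_rect[OF that that] by (simp_all add: rectangle_def)
  interpret confocal_flow c "a - m" T U V pu pv a b m lAB lBC lCD lDA F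
  proof
    show "a - b = c\<^sup>2" "a - m = a - m" "m \<noteq> a" "m \<noteq> b" by (use ab m_neq in auto)
    show "lAB = a - c\<^sup>2 * (cosh (U 0))\<^sup>2" "lBC = a - c\<^sup>2 * (cos (V T))\<^sup>2"
      "lCD = a - c\<^sup>2 * (cosh (U T))\<^sup>2" "lDA = a - c\<^sup>2 * (cos (V 0))\<^sup>2"
      using coords[of 0] const[of 0] by (simp_all add: uv_ends)
    show "lAB \<noteq> b" "lBC \<noteq> a" "lBC \<noteq> b" "lCD \<noteq> b" "lDA \<noteq> a" "lDA \<noteq> b"
      using types by (auto simp: is_ellipse_def is_hyperbola_def)
    show "pt (node x y) \<in> table F" if "x \<in> {0..T}" "y \<in> {0..T}" for x y
      using in_rect[OF that] by (auto simp: table node_def)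
    show "pt (node 0 y) \<in> side_AB F" "pt (node T y) \<in> side_CD F" if "y \<in> {0..T}" for y
      using UV[OF that] in_side[OF _ sub(1), of "Complex u0 (V y)"] in_side[OF _ sub(3), of "Complex u1 (V y)"]
      by (simp_all add: node_def side_AB_def side_CD_def image uv_ends)
    show "pt (node x T) \<in> side_BC F" "pt (node x 0) \<in> side_DA F" if "x \<in> {0..T}" for x
      using UV[OF that] in_side[OF _ sub(2), of "Complex (U x) v1"] in_side[OF _ sub(4), of "Complex (U x) v0"]
      by (simp_all add: node_def side_BC_def side_DA_def image uv_ends)
    show "corners F = {pt (node 0 0), pt (node 0 T), pt (node T T), pt (node T 0)}"
      using F_corner by (simp add: corners_def corners)
    show "U x = U x' \<and> V y = V y'" if "{x, y, x', y'} \<subseteq> {0..T}" "node x y = node x' y'" for x y x' y'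
      using inj_rect[OF in_rect in_rect, of x y x' y'] that c by (auto simp: node_def)
  qed (use interior in auto)
  have "trajectory_family a b m lAB lBC lCD lDA F A B C D"
    unfolding trajectory_family_def
    by (intro exI[of _ P] exI[of _ Q] exI[of _ R] exI[of _ S])
      (simp add: continuous_trajectory ends_trajectory F_corner trajectory perimeter_trajectory)
  then show ?thesis
    by (simp add: F_corner diagonal_tangent diagonals_equal)
qed

section \<open>Transposing the table: A and C stay, B and D change places\<close>

lemma transpose_sides:
  fixes F :: "point \<Rightarrow> point"
  shows "table (F \<circ> prod.swap) = table F" "corners (F \<circ> prod.swap) = corners F"
    "side_AB (F \<circ> prod.swap) = side_DA F" "side_BC (F \<circ> prod.swap) = side_CD F"
    "side_CD (F \<circ> prod.swap) = side_BC F" "side_DA (F \<circ> prod.swap) = side_AB F"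
  unfolding table_def unit_square_def side_AB_def side_BC_def side_CD_def side_DA_def
    image_comp[symmetric] product_swap
  by (auto simp: corners_def)

text \<open>AB is exchanged with DA and BC with CD, so the same closed path is read backwards,
  starting from its vertex on DA.\<close>

lemma billiard_trajectory_transpose:
  assumes "billiard_trajectory a b lDA lCD lBC lAB (F \<circ> prod.swap) S R Q P"
  shows "billiard_trajectory a b lAB lBC lCD lDA F P Q R S"
  using assms
  by (simp add: billiard_trajectory_def transpose_sides closed_segment_commute reflects_at_sym)

lemma rays_tangent_transpose: "rays_tangent a b m S R Q P \<Longrightarrow> rays_tangent a b m P Q R S"
  by (simp add: rays_tangent_def insert_commute)

lemma perimeter_transpose: "perimeter S R Q P = perimeter P Q R S"
  by (simp add: perimeter_def dist_commute)

lemma confocal_quadrilateral_transpose: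
  fixes F :: "point \<Rightarrow> point"
  assumes "confocal_quadrilateral a b lAB lBC lCD lDA F"
  shows "confocal_quadrilateral a b lDA lCD lBC lAB (F \<circ> prod.swap)"
proof -
  have swap: "prod.swap ` unit_square = unit_square"
    by (auto simp: unit_square_def image_iff)
  have "continuous_on unit_square (F \<circ> prod.swap)"
    using assms by (intro continuous_on_compose) (auto simp: confocal_quadrilateral_def swap intro: continuous_on_swap)
  moreover have "inj_on (F \<circ> prod.swap) unit_square"
    using assms by (intro comp_inj_on) (auto simp: confocal_quadrilateral_def swap)
  ultimately show ?thesis
    using assms by (auto simp: confocal_quadrilateral_def transpose_sides)
qed

lemma trajectory_family_transpose:
  assumes "trajectory_family a b m lDA lCD lBC lAB (F \<circ> prod.swap) A D C B"
  shows "trajectory_family a b m lAB lBC lCD lDA F A B C D"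
proof -
  obtain P Q R S :: "real \<Rightarrow> point" where
    "continuous_on {0..1} P" "continuous_on {0..1} Q" "continuous_on {0..1} R" "continuous_on {0..1} S"
    "P 0 = D" "Q 0 = D" "R 0 = B" "S 0 = B" "P 1 = A" "Q 1 = C" "R 1 = C" "S 1 = A"
    "\<forall>t\<in>{0<..<1}. billiard_trajectory a b lDA lCD lBC lAB (F \<circ> prod.swap) (P t) (Q t) (R t) (S t) \<and>
      rays_tangent a b m (P t) (Q t) (R t) (S t)"
    "\<forall>s\<in>{0..1}. \<forall>t\<in>{0..1}. perimeter (P s) (Q s) (R s) (S s) = perimeter (P t) (Q t) (R t) (S t)"
    using assms unfolding trajectory_family_def
  proof (elim exE conjE, goal_cases)
    case (1 P Q R S)
    show thesis by (rule 1(1)[of P Q R S]) (fact 1)+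
  qed
  note PQRS = this
  have "billiard_trajectory a b lAB lBC lCD lDA F (S t) (R t) (Q t) (P t) \<and>
      rays_tangent a b m (S t) (R t) (Q t) (P t)" if "t \<in> {0<..<1}" for t
    using PQRS(13) that billiard_trajectory_transpose rays_tangent_transpose by blast
  moreover have "\<forall>s\<in>{0..1}. \<forall>t\<in>{0..1}. perimeter (S s) (R s) (Q s) (P s) = perimeter (S t) (R t) (Q t) (P t)"
    using PQRS(14) unfolding perimeter_transpose[of "S _"] .
  ultimately show ?thesis
    unfolding trajectory_family_def using PQRS(1-12)
    by (intro exI[of _ S] exI[of _ R] exI[of _ Q] exI[of _ P] conjI) (assumption | blast)+
qed

theorem theorem1:
  fixes a b m lAB lBC lCD lDA :: real
    and F :: "point \<Rightarrow> point" and A B C D :: point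
  assumes "a > b" and "b > 0"
    and "confocal_quadrilateral a b lAB lBC lCD lDA F"
    and "A = F (0, 0)" and "B = F (1, 0)" and "C = F (1, 1)" and "D = F (0, 1)"
    and "closed_segment B D \<subseteq> table F"
    and "is_ellipse b m \<or> is_hyperbola a b m"
    and "tangent_to_conic a b m (affine hull {B, D})"
  shows "(\<exists>P Q R S :: real \<Rightarrow> point.
            continuous_on {0..1} P \<and> continuous_on {0..1} Q \<and>
            continuous_on {0..1} R \<and> continuous_on {0..1} S \<and>
            P 0 = B \<and> Q 0 = B \<and> R 0 = D \<and> S 0 = D \<and>
            P 1 = A \<and> Q 1 = C \<and> R 1 = C \<and> S 1 = A \<and>
            (\<forall>t \<in> {0<..<1}.
               billiard_trajectory a b lAB lBC lCD lDA F (P t) (Q t) (R t) (S t) \<and>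
               rays_tangent a b m (P t) (Q t) (R t) (S t)) \<and>
            (\<forall>s \<in> {0..1}. \<forall>t \<in> {0..1}.
               perimeter (P s) (Q s) (R s) (S s) = perimeter (P t) (Q t) (R t) (S t))) \<and>
         tangent_to_conic a b m (affine hull {A, C}) \<and>
         dist A C = dist B D"
proof -
  have "trajectory_family a b m lAB lBC lCD lDA F A B C D \<and>
      tangent_to_conic a b m (affine hull {A, C}) \<and> dist A C = dist B D"
  proof (cases "is_ellipse b lAB")
    case True
    show ?thesis
      by (rule ellipse_first[OF assms(1-3) True assms(4-10)])
  next
    case False
    \<comment> \<open>DA is the first side of the transposed table.\<close>
    have "is_ellipse b lDA"
      using assms(3) False by (auto simp: confocal_quadrilateral_def)
    then have "trajectory_family a b m lDA lCD lBC lAB (F \<circ> prod.swap) A D C B \<and>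
        tangent_to_conic a b m (affine hull {A, C}) \<and> dist A C = dist D B"
      using assms confocal_quadrilateral_transpose[OF assms(3)]
      by (intro ellipse_first) (simp_all add: transpose_sides closed_segment_commute insert_commute)
    then show ?thesis
      by (simp add: trajectory_family_transpose dist_commute)
  qed
  then show ?thesis
    by (simp only: trajectory_family_def)
qed

end
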